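(* Under the standing assumptions listed in the context, let $u$ denote the solution of the continuous problem $$\frac{\partial u}{\partial t}-\varepsilon\frac{\partial^2u}{\partial x^2}+a u=f\ \text{on }\Omega,\quad u(0,t)-\frac{\partial u}{\partial x}(0,t)=\phi_L(t),\quad u(1,t)+\frac{\partial u}{\partial x}(1,t)=\phi_R(t),\quad u(x,0)=\phi_B(x),$$ and let $U$ denote the solution of the discrete problem on the Shishkin mesh $\bar\Omega^{N,M}$ $$D_t^-U-\varepsilon\delta_x^2U+aU=f\ \text{on }\Omega^{N,M},\quad U(0,t_k)-D_x^+U(0,t_k)=\phi_L(t_k),\quad U(1,t_k)+D_x^-U(1,t_k)=\phi_R(t_k),\quad U(x_j,0)=\phi_B(x_j).$$ Then there is a constant $C$, independent of $\varepsilon\in(0,1]$, $N$ and $M$, such that $$\|U-u\|\le C\left(M^{-1}+N^{-1}\ln N\right).$$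
   Context: Let $T>0$, $0<\varepsilon\le1$, $\Omega=\{(x,t):0<x<1,\ 0<t\le T\}$, $\bar\Omega=[0,1]\times[0,T]$. In the continuous problem the boundary conditions hold for $0\le t\le T$ and the initial condition for $0\le x\le1$. The data $a,f,\phi_L,\phi_R,\phi_B$ do not depend on $\varepsilon$. Standing assumptions: (i) There is a constant $\alpha$ with $0<\alpha<a(x,t)$ for all $(x,t)\in\bar\Omega$. (ii) $a,f:\bar\Omega\to\mathbb R$ are sufficiently smooth (of class $C^k(\bar\Omega)$ for a sufficiently large fixed $k$), $\phi_L,\phi_R\in C^2([0,T])$, $\phi_B\in C^5([0,1])$. (iii) (Compatibility, for every $\varepsilon\in(0,1]$.) Put $g_0(x)=\phi_B(x)$, $g_1(x)=f(x,0)-a(x,0)\phi_B(x)+\varepsilon\phi_B''(x)$, $g_2(x)=\frac{\partial f}{\partial t}(x,0)-\frac{\partial a}{\partial t}(x,0)\phi_B(x)-a(x,0)g_1(x)+\varepsilon g_1''(x)$. Then for $k=0,1,2$: $\frac{d^k\phi_L}{dt^k}(0)=g_k(0)-g_k'(0)$ and $\frac{d^k\phi_R}{dt^k}(0)=g_k(1)+g_k'(1)$. The solution $u$ is understood as a classical solution for which all derivatives $\partial_x^i\partial_t^j$ with $i+2j\le4$ exist and are continuous on $\bar\Omega$. Shishkin mesh: $M\ge1$ and $N=4m$, $m\ge2$, are integers. $t_k=kT/M$, $0\le k\le M$. With $\sigma=\min\{\frac14,\ 2\frac{\sqrt\varepsilon}{\sqrt\alpha}\ln N\}$, the points $0=x_0<x_1<\dots<x_N=1$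 divide $[0,\sigma]$ uniformly into $N/4$ intervals, $[\sigma,1-\sigma]$ uniformly into $N/2$ intervals and $[1-\sigma,1]$ uniformly into $N/4$ intervals. $\bar\Omega^{N,M}=\{(x_j,t_k):0\le j\le N,0\le k\le M\}$, $\Omega^{N,M}=\{(x_j,t_k):1\le j\le N-1,1\le k\le M\}$. $U$ is a real function on $\bar\Omega^{N,M}$; its boundary conditions hold for $0\le k\le M$, where compatible with the initial values, and the initial condition for $0\le j\le N$ (at $k=0$ the values of $U$ are those given by $\phi_B$). Difference operators: $D_t^-U(x_j,t_k)=\frac{U(x_j,t_k)-U(x_j,t_{k-1})}{t_k-t_{k-1}}$, $D_x^+U(x_j,t_k)=\frac{U(x_{j+1},t_k)-U(x_j,t_k)}{x_{j+1}-x_j}$, $D_x^-U(x_j,t_k)=\frac{U(x_j,t_k)-U(x_{j-1},t_k)}{x_j-x_{j-1}}$, $\delta_x^2U(x_j,t_k)=\frac{2}{x_{j+1}-x_{j-1}}\left(D_x^+U-D_x^-U\right)(x_j,t_k)$. $\|U-u\|$ is the maximum of $|U-u|$ over $\bar\Omega^{N,M}$. *)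

theory Defs
  imports "HOL-Analysis.Analysis"
begin

section \<open>Derivatives and smoothness on the closed rectangle\<close>

text \<open>
  A function on \<open>[0,1] \<times> [0,T]\<close> is a curried function \<open>w x t\<close> on the reals; its values
  outside the rectangle are never used. Derivatives are taken relative to the closed
  interval, that is, they are one-sided at end points and ordinary derivatives in between.
\<close>

definition deriv_on :: "real \<Rightarrow> real \<Rightarrow> (real \<Rightarrow> real) \<Rightarrow> real \<Rightarrow> real" where
  "deriv_on p q g x = vector_derivative g (at x within {p..q})"

definition class_C :: "nat \<Rightarrow> real \<Rightarrow> real \<Rightarrow> (real \<Rightarrow> real) \<Rightarrow> bool" where
  "class_C n p q g \<longleftrightarrow>
     (\<forall>i<n. \<forall>x\<in>{p..q}. (deriv_on p q ^^ i) g differentiable (at x within {p..q})) \<and>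
     (\<forall>i\<le>n. continuous_on {p..q} ((deriv_on p q ^^ i) g))"

definition dx :: "(real \<Rightarrow> real \<Rightarrow> real) \<Rightarrow> real \<Rightarrow> real \<Rightarrow> real" where
  "dx w x t = deriv_on 0 1 (\<lambda>y. w y t) x"

definition dt :: "real \<Rightarrow> (real \<Rightarrow> real \<Rightarrow> real) \<Rightarrow> real \<Rightarrow> real \<Rightarrow> real" where
  "dt T w x t = deriv_on 0 T (\<lambda>s. w x s) t"

text \<open>The derivative \<open>\<partial>\<^sub>x\<^sup>i \<partial>\<^sub>t\<^sup>j w\<close>, the time derivatives being taken first.\<close>

definition partial :: "real \<Rightarrow> nat \<Rightarrow> nat \<Rightarrow> (real \<Rightarrow> real \<Rightarrow> real) \<Rightarrow> real \<Rightarrow> real \<Rightarrow> real" where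
  "partial T i j w = (dx ^^ i) ((dt T ^^ j) w)"

fun partial_exists :: "real \<Rightarrow> nat \<Rightarrow> nat \<Rightarrow> (real \<Rightarrow> real \<Rightarrow> real) \<Rightarrow> bool" where
  "partial_exists T 0 0 w \<longleftrightarrow> True"
| "partial_exists T 0 (Suc j) w \<longleftrightarrow> partial_exists T 0 j w \<and>
     (\<forall>x\<in>{0..1}. \<forall>t\<in>{0..T}. (\<lambda>s. partial T 0 j w x s) differentiable (at t within {0..T}))"
| "partial_exists T (Suc i) j w \<longleftrightarrow> partial_exists T i j w \<and>
     (\<forall>x\<in>{0..1}. \<forall>t\<in>{0..T}. (\<lambda>y. partial T i j w y t) differentiable (at x within {0..1}))"

definition continuous_partial :: "real \<Rightarrow> nat \<Rightarrow> nat \<Rightarrow> (real \<Rightarrow> real \<Rightarrow> real) \<Rightarrow> bool" where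
  "continuous_partial T i j w \<longleftrightarrow> partial_exists T i j w \<and>
     continuous_on ({0..1} \<times> {0..T}) (\<lambda>(x, t). partial T i j w x t)"

text \<open>
  Because all derivatives involved are continuous, mixed derivatives taken in any other
  order exist and agree with \<open>partial\<close> (Schwarz), so this is the usual class \<open>C\<^sup>k\<close>.
\<close>

definition class_C_rect :: "nat \<Rightarrow> real \<Rightarrow> (real \<Rightarrow> real \<Rightarrow> real) \<Rightarrow> bool" where
  "class_C_rect k T w \<longleftrightarrow> (\<forall>i j. i + j \<le> k \<longrightarrow> continuous_partial T i j w)"


section \<open>Data\<close>

definition g0 :: "(real \<Rightarrow> real) \<Rightarrow> real \<Rightarrow> real" where
  "g0 \<phi>B x = \<phi>B x"

definition g1 :: "(real \<Rightarrow> real \<Rightarrow> real) \<Rightarrow> (real \<Rightarrow> real \<Rightarrow> real) \<Rightarrow> (real \<Rightarrow> real) \<Rightarrow>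
    real \<Rightarrow> real \<Rightarrow> real" where
  "g1 a f \<phi>B \<epsilon> x = f x 0 - a x 0 * \<phi>B x + \<epsilon> * (deriv_on 0 1 ^^ 2) \<phi>B x"

definition g2 :: "real \<Rightarrow> (real \<Rightarrow> real \<Rightarrow> real) \<Rightarrow> (real \<Rightarrow> real \<Rightarrow> real) \<Rightarrow> (real \<Rightarrow> real) \<Rightarrow>
    real \<Rightarrow> real \<Rightarrow> real" where
  "g2 T a f \<phi>B \<epsilon> x = dt T f x 0 - dt T a x 0 * \<phi>B x - a x 0 * g1 a f \<phi>B \<epsilon> x
     + \<epsilon> * (deriv_on 0 1 ^^ 2) (g1 a f \<phi>B \<epsilon>) x"

definition corner_compatible :: "real \<Rightarrow> nat \<Rightarrow> (real \<Rightarrow> real) \<Rightarrow> (real \<Rightarrow> real) \<Rightarrow>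
    (real \<Rightarrow> real) \<Rightarrow> bool" where
  "corner_compatible T k g \<phi>L \<phi>R \<longleftrightarrow>
     (deriv_on 0 T ^^ k) \<phi>L 0 = g 0 - deriv_on 0 1 g 0 \<and>
     (deriv_on 0 T ^^ k) \<phi>R 0 = g 1 + deriv_on 0 1 g 1"

definition standing_assumptions :: "nat \<Rightarrow> real \<Rightarrow> real \<Rightarrow>
    (real \<Rightarrow> real \<Rightarrow> real) \<Rightarrow> (real \<Rightarrow> real \<Rightarrow> real) \<Rightarrow>
    (real \<Rightarrow> real) \<Rightarrow> (real \<Rightarrow> real) \<Rightarrow> (real \<Rightarrow> real) \<Rightarrow> bool" where
  "standing_assumptions K T \<alpha> a f \<phi>L \<phi>R \<phi>B \<longleftrightarrow>
     0 < T \<and>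
     0 < \<alpha> \<and> (\<forall>x\<in>{0..1}. \<forall>t\<in>{0..T}. \<alpha> < a x t) \<and>
     class_C_rect K T a \<and> class_C_rect K T f \<and>
     class_C 2 0 T \<phi>L \<and> class_C 2 0 T \<phi>R \<and> class_C 5 0 1 \<phi>B \<and>
     (\<forall>\<epsilon>. 0 < \<epsilon> \<and> \<epsilon> \<le> 1 \<longrightarrow>
        corner_compatible T 0 (g0 \<phi>B) \<phi>L \<phi>R \<and>
        corner_compatible T 1 (g1 a f \<phi>B \<epsilon>) \<phi>L \<phi>R \<and>
        corner_compatible T 2 (g2 T a f \<phi>B \<epsilon>) \<phi>L \<phi>R)"


section \<open>The continuous problem\<close>

definition continuous_solution :: "real \<Rightarrow> real \<Rightarrow>
    (real \<Rightarrow> real \<Rightarrow> real) \<Rightarrow> (real \<Rightarrow> real \<Rightarrow> real) \<Rightarrow>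
    (real \<Rightarrow> real) \<Rightarrow> (real \<Rightarrow> real) \<Rightarrow> (real \<Rightarrow> real) \<Rightarrow> (real \<Rightarrow> real \<Rightarrow> real) \<Rightarrow> bool" where
  "continuous_solution T \<epsilon> a f \<phi>L \<phi>R \<phi>B u \<longleftrightarrow>
     (\<forall>i j. i + 2 * j \<le> 4 \<longrightarrow> continuous_partial T i j u) \<and>
     (\<forall>x t. 0 < x \<and> x < 1 \<and> 0 < t \<and> t \<le> T \<longrightarrow>
        partial T 0 1 u x t - \<epsilon> * partial T 2 0 u x t + a x t * u x t = f x t) \<and>
     (\<forall>t\<in>{0..T}. u 0 t - partial T 1 0 u 0 t = \<phi>L t) \<and>
     (\<forall>t\<in>{0..T}. u 1 t + partial T 1 0 u 1 t = \<phi>R t) \<and>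
     (\<forall>x\<in>{0..1}. u x 0 = \<phi>B x)"


section \<open>The Shishkin mesh and the discrete problem\<close>

definition shishkin_sigma :: "real \<Rightarrow> real \<Rightarrow> nat \<Rightarrow> real" where
  "shishkin_sigma \<alpha> \<epsilon> N = min (1/4) (2 * (sqrt \<epsilon> / sqrt \<alpha>) * ln (real N))"

definition mesh_x :: "real \<Rightarrow> real \<Rightarrow> nat \<Rightarrow> nat \<Rightarrow> real" where
  "mesh_x \<alpha> \<epsilon> N j =
     (let \<sigma> = shishkin_sigma \<alpha> \<epsilon> N; n = real N; i = real j in
      if i \<le> n / 4 then i * (\<sigma> / (n / 4))
      else if i \<le> 3 * n / 4 then \<sigma> + (i - n / 4) * ((1 - 2 * \<sigma>) / (n / 2))
      else 1 - \<sigma> + (i - 3 * n / 4) * (\<sigma> / (n / 4)))"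

definition mesh_t :: "real \<Rightarrow> nat \<Rightarrow> nat \<Rightarrow> real" where
  "mesh_t T M k = real k * T / real M"

text \<open>
  A mesh function is given by its values \<open>U j k\<close> at the points \<open>(x\<^sub>j, t\<^sub>k)\<close>; only indices
  \<open>j \<le> N\<close>, \<open>k \<le> M\<close> matter. In the difference operators \<open>X\<close> and \<open>\<tau>\<close> are the sequences of
  mesh points.
\<close>

definition Dt_minus :: "(nat \<Rightarrow> real) \<Rightarrow> (nat \<Rightarrow> nat \<Rightarrow> real) \<Rightarrow> nat \<Rightarrow> nat \<Rightarrow> real" where
  "Dt_minus \<tau> U j k = (U j k - U j (k - 1)) / (\<tau> k - \<tau> (k - 1))"

definition Dx_plus :: "(nat \<Rightarrow> real) \<Rightarrow> (nat \<Rightarrow> nat \<Rightarrow> real) \<Rightarrow> nat \<Rightarrow> nat \<Rightarrow> real" where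
  "Dx_plus X U j k = (U (j + 1) k - U j k) / (X (j + 1) - X j)"

definition Dx_minus :: "(nat \<Rightarrow> real) \<Rightarrow> (nat \<Rightarrow> nat \<Rightarrow> real) \<Rightarrow> nat \<Rightarrow> nat \<Rightarrow> real" where
  "Dx_minus X U j k = (U j k - U (j - 1) k) / (X j - X (j - 1))"

definition delta_x2 :: "(nat \<Rightarrow> real) \<Rightarrow> (nat \<Rightarrow> nat \<Rightarrow> real) \<Rightarrow> nat \<Rightarrow> nat \<Rightarrow> real" where
  "delta_x2 X U j k = 2 / (X (j + 1) - X (j - 1)) * (Dx_plus X U j k - Dx_minus X U j k)"

text \<open>
  At \<open>k = 0\<close> the values are those of \<open>\<phi>B\<close>, so the difference boundary conditions are imposed
  only for \<open>1 \<le> k \<le> M\<close>: at the two corners they would in general contradict the initial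
  values.
\<close>

definition discrete_solution :: "real \<Rightarrow> real \<Rightarrow> real \<Rightarrow> nat \<Rightarrow> nat \<Rightarrow>
    (real \<Rightarrow> real \<Rightarrow> real) \<Rightarrow> (real \<Rightarrow> real \<Rightarrow> real) \<Rightarrow>
    (real \<Rightarrow> real) \<Rightarrow> (real \<Rightarrow> real) \<Rightarrow> (real \<Rightarrow> real) \<Rightarrow> (nat \<Rightarrow> nat \<Rightarrow> real) \<Rightarrow> bool" where
  "discrete_solution T \<alpha> \<epsilon> N M a f \<phi>L \<phi>R \<phi>B U \<longleftrightarrow>
     (let X = mesh_x \<alpha> \<epsilon> N; \<tau> = mesh_t T M in
      (\<forall>j\<in>{1..N-1}. \<forall>k\<in>{1..M}.
         Dt_minus \<tau> U j k - \<epsilon> * delta_x2 X U j k + a (X j) (\<tau> k) * U j k = f (X j) (\<tau> k)) \<and>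
      (\<forall>k\<in>{1..M}. U 0 k - Dx_plus X U 0 k = \<phi>L (\<tau> k)) \<and>
      (\<forall>k\<in>{1..M}. U N k + Dx_minus X U N k = \<phi>R (\<tau> k)) \<and>
      (\<forall>j\<in>{0..N}. U j 0 = \<phi>B (X j)))"

definition max_error :: "real \<Rightarrow> real \<Rightarrow> real \<Rightarrow> nat \<Rightarrow> nat \<Rightarrow>
    (nat \<Rightarrow> nat \<Rightarrow> real) \<Rightarrow> (real \<Rightarrow> real \<Rightarrow> real) \<Rightarrow> real" where
  "max_error T \<alpha> \<epsilon> N M U u =
     Max ((\<lambda>(j, k). \<bar>U j k - u (mesh_x \<alpha> \<epsilon> N j) (mesh_t T M k)\<bar>) ` ({0..N} \<times> {0..M}))"

end

theory Submission
  imports Defs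
begin

text \<open>
  In the Robin conditions \<open>u\<^sub>x\<close> is not scaled by \<open>\<surd>\<epsilon>\<close>, so the boundary layers are weak:
  \<open>u\<^sub>x\<close>, \<open>u\<^sub>t\<close>, \<open>u\<^sub>t\<^sub>t\<close>, \<open>u\<^sub>x\<^sub>t\<close>, \<open>\<surd>\<epsilon> u\<^sub>x\<^sub>x\<close> and \<open>\<epsilon> u\<^sub>x\<^sub>x\<^sub>x\<close> are all bounded uniformly in \<open>\<epsilon>\<close>,
  and no decomposition of \<open>u\<close> is needed. Indeed \<open>u\<close> and \<open>u\<^sub>t\<close> solve Robin problems and \<open>u\<^sub>x\<close> solves a
  Dirichlet problem for the same operator, with data that are Lipschitz in time; by the maximum
  principle the three functions are Lipschitz in time. The equation for \<open>u\<^sub>x\<close> then bounds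
  \<open>\<epsilon> u\<^sub>x\<^sub>x\<^sub>x\<close>, and interpolation bounds \<open>\<surd>\<epsilon> u\<^sub>x\<^sub>x\<close>. Consequently the truncation error is
  \<open>O(1/M + 1/N)\<close> at interior mesh points and, the mesh width next to the boundary being
  \<open>O(\<surd>\<epsilon> ln N / N)\<close>, it is \<open>O(ln N / N)\<close> in the boundary conditions. The discrete maximum
  principle concludes.
\<close>

section \<open>Real calculus\<close>

text \<open>The regularity of \<open>u\<close> stops at \<open>i + 2 * j \<le> 4\<close>:
  \<open>u_tt\<close> and \<open>u_xt\<close> exist, but not the derivatives needed to state a
  parabolic equation for them. They are therefore never treated as solutions. Instead
  \<open>u\<close>, \<open>u_t\<close> and \<open>u_x\<close> are compared with their own time
  shifts, and a Lipschitz constant stands in for a bound on the next time derivative. The order of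
  the estimates is forced: the sources of the problems for \<open>u_t\<close> and \<open>u_x\<close>
  contain \<open>u\<close>, and the Robin conditions turn \<open>u - \<phi>L\<close> and
  \<open>\<phi>R - u\<close> into the Dirichlet values of \<open>u_x\<close>. That these values are
  bounded independently of \<epsilon> is what keeps the layers weak. Initial rates of change carry
  no negative power of \<epsilon>, since at \<open>t = 0\<close> the equation expresses them by
  derivatives of \<open>\<phi>B\<close>. In the interior rows a mesh width of order
  \<open>1 / N\<close> is enough, because it multiplies \<open>\<epsilon> * u_xxx\<close>; the fine
  part of the mesh acts in the boundary rows, where it compensates the factor
  \<open>1 / sqrt \<epsilon>\<close> in \<open>u_xx\<close>.\<close>

lemma derivative_growth_bound:
  fixes g g' :: "real \<Rightarrow> real"
  assumes "convex S" "x \<in> S" "s \<in> S" "0 \<le> B"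
    and "\<And>y. y \<in> S \<Longrightarrow> (g has_real_derivative g' y) (at y within S)"
    and "\<And>y. y \<in> S \<Longrightarrow> \<bar>g' y\<bar> \<le> B * \<bar>y - x\<bar> ^ n"
  shows "\<bar>g s - g x\<bar> \<le> B * \<bar>s - x\<bar> ^ Suc n"
proof -
  \<comment> \<open>On the segment between \<open>x\<close> and \<open>s\<close> the power bound
    becomes the constant \<open>B * |s - x| ^ n\<close>. The factor \<open>1 / (n + 1)\<close> of
    exact integration is given away, so iterating the lemma yields Taylor remainders without
    factorials.\<close>
  define S' where "S' = closed_segment x s"
  have sub: "S' \<subseteq> S"
    unfolding S'_def using assms(1-3) by (rule closed_segment_subset[rotated 2])
  have "norm (g s - g x) \<le> B * \<bar>s - x\<bar> ^ n * norm (s - x)"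
  proof (rule field_differentiable_bound[of S'])
    show "convex S'" "s \<in> S'" "x \<in> S'" by (auto simp: S'_def)
    fix y assume y: "y \<in> S'"
    show "(g has_real_derivative g' y) (at y within S')"
      using assms(5) y sub by (meson DERIV_subset subsetD)
    have "\<bar>y - x\<bar> \<le> \<bar>s - x\<bar>"
      using y by (auto simp: S'_def closed_segment_eq_real_ivl split: if_splits)
    then have "B * \<bar>y - x\<bar> ^ n \<le> B * \<bar>s - x\<bar> ^ n"
      using assms(4) by (intro mult_left_mono power_mono) auto
    then show "norm (g' y) \<le> B * \<bar>s - x\<bar> ^ n"
      using assms(6) y sub by (metis order_trans real_norm_def subsetD)
  qed
  then show ?thesis by (simp add: mult_ac)
qed

text \<open>A bound on difference quotients near \<open>x\<close> survives in the limit.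
  \<open>S\<close> may be a closed interval with end point \<open>x\<close>, which covers one-sided
  derivatives.\<close>

lemma derivative_close_to_slope:
  fixes F :: "real \<Rightarrow> real"
  assumes D: "(F has_real_derivative D) (at x within S)" and nt: "at x within S \<noteq> bot"
    and ev: "eventually (\<lambda>y. \<bar>F y - F x - m * (y - x)\<bar> \<le> K * \<bar>y - x\<bar>) (at x within S)"
  shows "\<bar>D - m\<bar> \<le> K"
proof -
  have "((\<lambda>y. \<bar>(F y - F x) / (y - x) - m\<bar>) \<longlongrightarrow> \<bar>D - m\<bar>) (at x within S)"
    using D unfolding has_field_derivative_iff by (intro tendsto_intros)
  moreover have "eventually (\<lambda>y. \<bar>(F y - F x) / (y - x) - m\<bar> \<le> K) (at x within S)"
    using ev eventually_neq_at_within[of x x S]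
  proof eventually_elim
    case (elim y)
    then have "(F y - F x) / (y - x) - m = (F y - F x - m * (y - x)) / (y - x)"
      by (simp add: field_simps)
    then show ?case using elim by (simp add: abs_divide divide_le_eq)
  qed
  ultimately show ?thesis using nt tendsto_upperbound by blast
qed

lemma derivative_le_lipschitz:
  fixes F :: "real \<Rightarrow> real"
  assumes "p < q" "x \<in> {p..q}" "(F has_real_derivative D) (at x within {p..q})"
    and "\<And>y. y \<in> {p..q} \<Longrightarrow> \<bar>F y - F x\<bar> \<le> K * \<bar>y - x\<bar>"
  shows "\<bar>D\<bar> \<le> K"
proof -
  have "\<bar>D - 0\<bar> \<le> K"
  proof (rule derivative_close_to_slope[OF assms(3)])
    show "at x within {p..q} \<noteq> bot"
      using assms(1,2) by (simp add: trivial_limit_within islimpt_Icc)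
    show "\<forall>\<^sub>F y in at x within {p..q}. \<bar>F y - F x - 0 * (y - x)\<bar> \<le> K * \<bar>y - x\<bar>"
      using assms(4) by (auto simp: eventually_at_filter)
  qed
  then show ?thesis by simp
qed

text \<open>Landau interpolation: a first-order Taylor expansion over a step of length
  \<open>d / 2\<close> expresses \<open>g' x\<close> by two values of \<open>g\<close> and a
  remainder. The length \<open>d\<close> is left free, to be balanced against \<open>A\<close> and
  \<open>B\<close> later.\<close>

lemma landau_derivative_bound:
  fixes g g' g'' :: "real \<Rightarrow> real"
  assumes g: "\<And>x. x \<in> {0..1} \<Longrightarrow> (g has_real_derivative g' x) (at x within {0..1})"
    and g': "\<And>x. x \<in> {0..1} \<Longrightarrow> (g' has_real_derivative g'' x) (at x within {0..1})"
    and A: "\<And>x. x \<in> {0..1} \<Longrightarrow> \<bar>g x\<bar> \<le> A"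
    and B: "\<And>x. x \<in> {0..1} \<Longrightarrow> \<bar>g'' x\<bar> \<le> B"
    and d: "0 < d" "d \<le> 1" and x: "x \<in> {0..1}"
  shows "\<bar>g' x\<bar> \<le> 4 * A / d + B * d"
proof -
  \<comment> \<open>The step goes towards the farther end point, so \<open>s\<close> stays in the
    interval for every \<open>d \<le> 1\<close>.\<close>
  define s where "s = (if x \<le> 1/2 then x + d / 2 else x - d / 2)"
  have s: "s \<in> {0..1}" "\<bar>s - x\<bar> = d / 2" using d x by (auto simp: s_def)
  have B0: "0 \<le> B" using B[OF x] by linarith
  have 1: "\<bar>g' y - g' x\<bar> \<le> B * \<bar>y - x\<bar> ^ Suc 0" if "y \<in> {0..1}" for y
    by (rule derivative_growth_bound[of "{0..1}" _ _ _ _ g'']) (use that x B0 B g' in auto)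
  have *: "\<bar>(g s - g' x * s) - (g x - g' x * x)\<bar> \<le> B * \<bar>s - x\<bar> ^ Suc (Suc 0)"
    by (rule derivative_growth_bound[of "{0..1}" _ _ _ _ "\<lambda>y. g' y - g' x"])
       (use s x B0 1 in \<open>auto intro!: derivative_eq_intros g\<close>)
  have "\<bar>g' x * (s - x)\<bar> \<le> B * (d/2)^2 + \<bar>g s\<bar> + \<bar>g x\<bar>"
  proof -
    have "g' x * (s - x) = g' x * s - g' x * x" by (rule right_diff_distrib)
    moreover have "B * \<bar>s - x\<bar> ^ Suc (Suc 0) = B * (d/2)^2" by (simp add: s(2) power2_eq_square)
    ultimately show ?thesis using * by linarith
  qed
  also have "\<dots> \<le> B * (d/2)^2 + 2 * A" using A[OF s(1)] A[OF x] by linarith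
  finally have "\<bar>g' x\<bar> * (d / 2) \<le> B * (d/2)^2 + 2 * A" by (simp add: abs_mult s(2))
  then have "\<bar>g' x\<bar> \<le> 4 * A / d + B * d / 2"
    using d by (simp add: field_simps power2_eq_square)
  also have "\<dots> \<le> 4 * A / d + B * d" using B0 d by simp
  finally show ?thesis .
qed

text \<open>Since \<open>partial\<close> takes time derivatives first, differentiating an
  \<open>x\<close>-derivative in time needs an exchange of order. The mixed second difference of
  \<open>w\<close> over the rectangle with corners \<open>(x, t)\<close> and \<open>(y, s)\<close>
  is estimated by two mean value inequalities, in \<open>x\<close> for \<open>v\<close> and then in
  \<open>t\<close> for \<open>w\<close>.\<close>

lemma schwarz_rectangle:
  fixes w v wx vx :: "real \<Rightarrow> real \<Rightarrow> real"
  assumes T: "0 < T"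
    and wt: "\<And>x t. x \<in> {0..1} \<Longrightarrow> t \<in> {0..T} \<Longrightarrow> (w x has_real_derivative v x t) (at t within {0..T})"
    and wx: "\<And>x t. x \<in> {0..1} \<Longrightarrow> t \<in> {0..T} \<Longrightarrow>
        ((\<lambda>y. w y t) has_real_derivative wx x t) (at x within {0..1})"
    and vx: "\<And>x t. x \<in> {0..1} \<Longrightarrow> t \<in> {0..T} \<Longrightarrow>
        ((\<lambda>y. v y t) has_real_derivative vx x t) (at x within {0..1})"
    and cont: "continuous_on ({0..1} \<times> {0..T}) (\<lambda>(x, t). vx x t)"
    and x: "x \<in> {0..1}" and t: "t \<in> {0..T}"
  shows "(wx x has_real_derivative vx x t) (at t within {0..T})"
  unfolding has_field_derivative_def has_derivative_within_alt2
proof (intro conjI allI impI)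
  show "bounded_linear ((*) (vx x t))" by (rule bounded_linear_mult_right)
  fix e :: real assume e: "0 < e"
  define c where "c = vx x t"
  obtain d where d: "d > 0"
    and cl: "\<And>y s. y \<in> {0..1} \<Longrightarrow> s \<in> {0..T} \<Longrightarrow> \<bar>y - x\<bar> < d \<Longrightarrow> \<bar>s - t\<bar> < d \<Longrightarrow> \<bar>vx y s - c\<bar> \<le> e"
  proof -
    obtain d where d: "d > 0" and
      h: "\<And>p. p \<in> {0..1} \<times> {0..T} \<Longrightarrow> dist p (x, t) < d \<Longrightarrow>
        dist ((\<lambda>(x, t). vx x t) p) ((\<lambda>(x, t). vx x t) (x, t)) < e"
      using cont x t e unfolding continuous_on_iff by (metis SigmaI)
    have "\<bar>vx y s - c\<bar> \<le> e" if "y \<in> {0..1}" "s \<in> {0..T}" "\<bar>y - x\<bar> < d/2" "\<bar>s - t\<bar> < d/2" for y s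
    proof -
      have "dist (y, s) (x, t) \<le> \<bar>y - x\<bar> + \<bar>s - t\<bar>"
        unfolding dist_Pair_Pair dist_real_def using sqrt_sum_squares_le_sum_abs by auto
      then show ?thesis using h[of "(y, s)"] that by (auto simp: dist_real_def c_def)
    qed
    then show ?thesis using that[of "d/2"] d by auto
  qed
  have main: "\<bar>wx x s - wx x t - c * (s - t)\<bar> \<le> e * \<bar>s - t\<bar>" if s: "s \<in> {0..T}" "\<bar>s - t\<bar> < d" for s
  proof -
    have D: "((\<lambda>y. w y s - w y t) has_real_derivative wx x s - wx x t) (at x within {0..1})"
      using x s t by (intro derivative_intros wx) auto
    have nb: "\<bar>(w y s - w y t) - (w x s - w x t) - c * (s - t) * (y - x)\<bar> \<le> e * \<bar>s - t\<bar> * \<bar>y - x\<bar>"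
      if y: "y \<in> {0..1}" "\<bar>y - x\<bar> < d" for y
    proof -
      define S where "S = {0..T} \<inter> {t - d<..<t + d}"
      have S: "convex S" "s \<in> S" "t \<in> S" using s t d by (auto simp: S_def intro: convex_Int)
      have b: "\<bar>v y r - v x r - c * (y - x)\<bar> \<le> e * \<bar>y - x\<bar>" if r: "r \<in> S" for r
      proof -
        define X where "X = {0..1} \<inter> {x - d<..<x + d}"
        have X: "convex X" "y \<in> X" "x \<in> X" using x y d by (auto simp: X_def intro: convex_Int)
        have r': "r \<in> {0..T}" "\<bar>r - t\<bar> < d" using r by (auto simp: S_def)
        have "\<bar>(v y r - c * y) - (v x r - c * x)\<bar> \<le> e * \<bar>y - x\<bar> ^ Suc 0"
        proof (rule derivative_growth_bound[OF X(1) X(3) X(2), where g' = "\<lambda>z. vx z r - c"])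
          fix z assume z: "z \<in> X"
          then have z': "z \<in> {0..1}" "\<bar>z - x\<bar> < d" by (auto simp: X_def)
          have "((\<lambda>z. v z r) has_real_derivative vx z r) (at z within X)"
            using vx[OF z'(1) r'(1)] by (rule DERIV_subset) (auto simp: X_def)
          then show "((\<lambda>z. v z r - c * z) has_real_derivative vx z r - c) (at z within X)"
            by (auto intro!: derivative_eq_intros)
          show "\<bar>vx z r - c\<bar> \<le> e * \<bar>z - x\<bar> ^ 0" using cl z' r' by simp
        qed (use e in auto)
        then show ?thesis by (simp add: algebra_simps)
      qed
      have "\<bar>(w y s - w x s - c * (y - x) * s) - (w y t - w x t - c * (y - x) * t)\<bar>
          \<le> (e * \<bar>y - x\<bar>) * \<bar>s - t\<bar> ^ Suc 0"
      proof (rule derivative_growth_bound[OF S(1) S(3) S(2), where g' = "\<lambda>r. v y r - v x r - c * (y - x)"])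
        fix r assume r: "r \<in> S"
        then have r': "r \<in> {0..T}" by (auto simp: S_def)
        have "(w y has_real_derivative v y r) (at r within S)" "(w x has_real_derivative v x r) (at r within S)"
          using wt[OF y(1) r'] wt[OF x r'] by (auto intro: DERIV_subset simp: S_def)
        then show "((\<lambda>s. w y s - w x s - c * (y - x) * s) has_real_derivative v y r - v x r - c * (y - x))
            (at r within S)"
          by (auto intro!: derivative_eq_intros)
        show "\<bar>v y r - v x r - c * (y - x)\<bar> \<le> e * \<bar>y - x\<bar> * \<bar>r - t\<bar> ^ 0" using b[OF r] by simp
      qed (use e in auto)
      then show ?thesis by (simp add: algebra_simps)
    qed
    \<comment> \<open>The times are fixed and \<open>y\<close> tends to \<open>x\<close>: by
      \<open>nb\<close>, the increment \<open>w y s - w y t\<close> has a slope within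
      \<open>e * |s - t|\<close> of \<open>c * (s - t)\<close>.\<close>
    show ?thesis
    proof (rule derivative_close_to_slope[OF D])
      show "at x within {0..1} \<noteq> bot" using x by (simp add: trivial_limit_within islimpt_Icc)
      show "\<forall>\<^sub>F y in at x within {0..1}. \<bar>w y s - w y t - (w x s - w x t) - c * (s - t) * (y - x)\<bar>
          \<le> e * \<bar>s - t\<bar> * \<bar>y - x\<bar>"
        unfolding eventually_at using nb d by (auto simp: dist_real_def)
    qed
  qed
  show "\<forall>\<^sub>F s in at t within {0..T}. norm (wx x s - wx x t - vx x t * (s - t)) \<le> e * norm (s - t)"
    unfolding eventually_at using main d by (auto simp: dist_real_def c_def)
qed

section \<open>Maximum principle and regularity in time\<close>

text \<open>At an interior minimum \<open>g'\<close> vanishes; a negative second derivative would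
  make \<open>g'\<close> negative just to the right of \<open>x\<close>, and \<open>g\<close> would
  fall below its minimum.\<close>

lemma second_derivative_nonneg_at_min:
  fixes g g' :: "real \<Rightarrow> real"
  assumes x: "p < x" "x < q"
    and g: "\<And>y. y \<in> {p..q} \<Longrightarrow> (g has_real_derivative g' y) (at y within {p..q})"
    and g': "(g' has_real_derivative g'') (at x within {p..q})"
    and min: "\<And>y. y \<in> {p..q} \<Longrightarrow> g x \<le> g y"
  shows "0 \<le> g''"
proof (rule ccontr)
  assume neg: "\<not> 0 \<le> g''"
  have at: "at y within {p..q} = at y" if "p < y" "y < q" for y
    using that by (intro at_within_interior) simp
  have "g' x = 0"
  proof (rule DERIV_local_min)
    show "(g has_real_derivative g' x) (at x)" using g[of x] x at by simp
    show "0 < min (x - p) (q - x)" using x by simp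
    show "\<forall>y. \<bar>x - y\<bar> < min (x - p) (q - x) \<longrightarrow> g x \<le> g y"
      using min by (auto simp: abs_less_iff)
  qed
  moreover obtain d where d: "d > 0" "\<And>h. 0 < h \<Longrightarrow> x + h \<in> {p..q} \<Longrightarrow> h < d \<Longrightarrow> g' (x + h) < g' x"
    using has_real_derivative_neg_dec_right[OF g'] neg by force
  ultimately have dec: "g' y < 0" if "x < y" "y < x + d" "y \<le> q" for y
    using d(2)[of "y - x"] that x by simp
  define b where "b = min (x + d / 2) ((x + q) / 2)"
  have b: "x < b" "b < x + d" "b < q" using x d by (auto simp: b_def min_def field_simps)
  obtain z where z: "x < z" "z < b" "g b - g x = (b - x) * g' z"
  proof (rule MVT2[of x b g g', THEN exE])
    fix y assume "x \<le> y" "y \<le> b"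
    then show "(g has_real_derivative g' y) (at y)" using g[of y] at[of y] x b by simp
  qed (use b that in auto)
  then have "g b < g x" using dec[of z] b by (smt (verit) mult_pos_neg)
  then show False using min[of b] x b by simp
qed

text \<open>The parameter \<open>\<kappa>\<close> covers both Robin (\<open>\<kappa> = 1\<close>) and Dirichlet (\<open>\<kappa> = 0\<close>) conditions.\<close>

definition parabolic_solution :: "real \<Rightarrow> real \<Rightarrow> real \<Rightarrow> (real \<Rightarrow> real \<Rightarrow> real) \<Rightarrow>
    (real \<Rightarrow> real \<Rightarrow> real) \<Rightarrow> (real \<Rightarrow> real) \<Rightarrow> (real \<Rightarrow> real) \<Rightarrow> (real \<Rightarrow> real \<Rightarrow> real) \<Rightarrow>
    (real \<Rightarrow> real \<Rightarrow> real) \<Rightarrow> (real \<Rightarrow> real \<Rightarrow> real) \<Rightarrow> (real \<Rightarrow> real \<Rightarrow> real) \<Rightarrow> bool" where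
  "parabolic_solution T \<epsilon> \<kappa> b G \<psi>0 \<psi>1 w wt wx wxx \<longleftrightarrow>
     continuous_on ({0..1} \<times> {0..T}) (\<lambda>(x, t). w x t) \<and>
     (\<forall>x\<in>{0..1}. \<forall>t\<in>{0..T}.
        (w x has_real_derivative wt x t) (at t within {0..T}) \<and>
        ((\<lambda>y. w y t) has_real_derivative wx x t) (at x within {0..1}) \<and>
        ((\<lambda>y. wx y t) has_real_derivative wxx x t) (at x within {0..1}) \<and>
        wt x t - \<epsilon> * wxx x t + b x t * w x t = G x t) \<and>
     (\<forall>t\<in>{0..T}. w 0 t - \<kappa> * wx 0 t = \<psi>0 t \<and> w 1 t + \<kappa> * wx 1 t = \<psi>1 t)"

text \<open>At a negative minimum inside, \<open>wt \<le> 0\<close>, \<open>wxx \<ge> 0\<close> and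
  \<open>b * w < 0\<close> contradict the sign of \<open>G\<close>; strict positivity of
  \<open>b\<close> spares the usual perturbation of \<open>w\<close>. At the two ends the sign of
  \<open>wx\<close> makes the boundary expression negative; for \<open>\<kappa> = 0\<close> the
  value of \<open>w\<close> alone does so.\<close>

lemma parabolic_minimum_principle:
  assumes w: "parabolic_solution T \<epsilon> \<kappa> b G \<psi>0 \<psi>1 w wt wx wxx"
    and T: "0 \<le> T" and \<epsilon>: "0 < \<epsilon>" and \<kappa>: "0 \<le> \<kappa>"
    and b: "\<And>x t. x \<in> {0..1} \<Longrightarrow> t \<in> {0..T} \<Longrightarrow> 0 < b x t"
    and G: "\<And>x t. x \<in> {0..1} \<Longrightarrow> t \<in> {0..T} \<Longrightarrow> 0 \<le> G x t"
    and \<psi>: "\<And>t. t \<in> {0..T} \<Longrightarrow> 0 \<le> \<psi>0 t \<and> 0 \<le> \<psi>1 t"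
    and init: "\<And>x. x \<in> {0..1} \<Longrightarrow> 0 \<le> w x 0"
    and x: "x \<in> {0..1}" and t: "t \<in> {0..T}"
  shows "0 \<le> w x t"
proof (rule ccontr)
  assume neg: "\<not> 0 \<le> w x t"
  have "compact ({0..1::real} \<times> {0..T})" by (intro compact_Times compact_Icc)
  from continuous_attains_inf[OF this, of "\<lambda>(x, t). w x t"] w T obtain x0 t0
    where x0: "x0 \<in> {0..1}" and t0: "t0 \<in> {0..T}"
    and min: "\<And>x t. x \<in> {0..1} \<Longrightarrow> t \<in> {0..T} \<Longrightarrow> w x0 t0 \<le> w x t"
    unfolding parabolic_solution_def by fastforce
  have lt: "w x0 t0 < 0" using min[OF x t] neg by linarith
  have dw: "(w x0 has_real_derivative wt x0 t0) (at t0 within {0..T})"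
      "\<And>y. y \<in> {0..1} \<Longrightarrow> ((\<lambda>y. w y t0) has_real_derivative wx y t0) (at y within {0..1})"
      "((\<lambda>y. wx y t0) has_real_derivative wxx x0 t0) (at x0 within {0..1})"
      "wt x0 t0 - \<epsilon> * wxx x0 t0 + b x0 t0 * w x0 t0 = G x0 t0"
      "w 0 t0 - \<kappa> * wx 0 t0 = \<psi>0 t0" "w 1 t0 + \<kappa> * wx 1 t0 = \<psi>1 t0"
    using w x0 t0 unfolding parabolic_solution_def by auto
  have t0pos: "0 < t0" using init[OF x0] lt t0 by (cases "t0 = 0") auto
  \<comment> \<open>Only earlier times are compared, so a minimum at the final time is
    included.\<close>
  have "wt x0 t0 \<le> 0"
  proof (rule ccontr)
    assume "\<not> wt x0 t0 \<le> 0"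
    then obtain d where d: "d > 0" "\<And>h. 0 < h \<Longrightarrow> t0 - h \<in> {0..T} \<Longrightarrow> h < d \<Longrightarrow> w x0 (t0 - h) < w x0 t0"
      using has_real_derivative_pos_inc_left[OF dw(1)] by force
    define h where "h = min (d / 2) t0"
    have "0 < h" "t0 - h \<in> {0..T}" "h < d" using d t0 t0pos by (auto simp: h_def)
    then show False using d(2) min[OF x0] by (meson not_less)
  qed
  consider "x0 = 0" | "x0 = 1" | "0 < x0" "x0 < 1" using x0 by fastforce
  then show False
  proof cases
    case 1
    have "0 \<le> wx 0 t0"
    proof (rule ccontr)
      assume "\<not> 0 \<le> wx 0 t0"
      then obtain d where d: "d > 0" "\<And>h. 0 < h \<Longrightarrow> h \<in> {0..1} \<Longrightarrow> h < d \<Longrightarrow> w h t0 < w 0 t0"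
        using has_real_derivative_neg_dec_right[OF dw(2)[of 0]] by force
      have "0 < min (d/2) 1" "min (d/2) 1 \<in> {0..1}" "min (d/2) 1 < d" using d(1) by auto
      then show False using d(2) min[OF _ t0] unfolding 1 by (meson not_less)
    qed
    then show False using dw(5) \<psi>[OF t0] \<kappa> lt 1 by (smt (verit) mult_nonneg_nonneg)
  next
    case 2
    have "wx 1 t0 \<le> 0"
    proof (rule ccontr)
      assume "\<not> wx 1 t0 \<le> 0"
      then obtain d where d: "d > 0" "\<And>h. 0 < h \<Longrightarrow> 1 - h \<in> {0..1} \<Longrightarrow> h < d \<Longrightarrow> w (1 - h) t0 < w 1 t0"
        using has_real_derivative_pos_inc_left[OF dw(2)[of 1]] by force
      have "0 < min (d/2) 1" "1 - min (d/2) 1 \<in> {0..1}" "min (d/2) 1 < d" using d(1) by auto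
      then show False using d(2) min[OF _ t0] unfolding 2 by (meson not_less)
    qed
    then have "\<kappa> * wx 1 t0 \<le> 0" using \<kappa> by (simp add: mult_nonneg_nonpos)
    then show False using dw(6) \<psi>[OF t0] lt 2 by simp
  next
    case 3
    have "0 \<le> wxx x0 t0"
      by (rule second_derivative_nonneg_at_min[OF 3 dw(2,3)]) (use min t0 in auto)
    moreover have "b x0 t0 * w x0 t0 < 0" using b[OF x0 t0] lt by (simp add: mult_pos_neg)
    ultimately show False
      using dw(4) G[OF x0 t0] \<open>wt x0 t0 \<le> 0\<close> \<epsilon> by (smt (verit) mult_nonneg_nonneg)
  qed
qed

text \<open>The comparison function \<open>c0 + c1 * t\<close> is constant in \<open>x\<close>, so
  Robin and Dirichlet expressions both reproduce it, while the differential operator maps it to at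
  least \<open>c1 + \<alpha> * c0\<close>. The minimum principle is applied to its sum with
  \<open>w\<close> and with \<open>- w\<close>.\<close>

lemma parabolic_barrier:
  assumes w: "parabolic_solution T \<epsilon> \<kappa> b G \<psi>0 \<psi>1 w wt wx wxx"
    and T: "0 \<le> T" and \<epsilon>: "0 < \<epsilon>" and \<kappa>: "0 \<le> \<kappa>" and \<alpha>: "0 < \<alpha>"
    and c: "0 \<le> c0" "0 \<le> c1"
    and b: "\<And>x t. x \<in> {0..1} \<Longrightarrow> t \<in> {0..T} \<Longrightarrow> \<alpha> \<le> b x t"
    and G: "\<And>x t. x \<in> {0..1} \<Longrightarrow> t \<in> {0..T} \<Longrightarrow> \<bar>G x t\<bar> \<le> c1 + \<alpha> * c0"
    and \<psi>: "\<And>t. t \<in> {0..T} \<Longrightarrow> \<bar>\<psi>0 t\<bar> \<le> c0 + c1 * t \<and> \<bar>\<psi>1 t\<bar> \<le> c0 + c1 * t"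
    and init: "\<And>x. x \<in> {0..1} \<Longrightarrow> \<bar>w x 0\<bar> \<le> c0"
    and x: "x \<in> {0..1}" and t: "t \<in> {0..T}"
  shows "\<bar>w x t\<bar> \<le> c0 + c1 * t"
proof -
  have "0 \<le> c0 + c1 * t + s * w x t" if s: "s = 1 \<or> s = -1" for s
  proof -
    let ?G = "\<lambda>x t. c1 + b x t * (c0 + c1 * t) + s * G x t"
    let ?\<psi> = "\<lambda>\<psi> t. c0 + c1 * t + s * \<psi> t"
    have "parabolic_solution T \<epsilon> \<kappa> b ?G (?\<psi> \<psi>0) (?\<psi> \<psi>1) (\<lambda>x t. c0 + c1 * t + s * w x t)
        (\<lambda>x t. c1 + s * wt x t) (\<lambda>x t. s * wx x t) (\<lambda>x t. s * wxx x t)"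
      unfolding parabolic_solution_def
    proof (intro conjI ballI)
      have "continuous_on ({0..1} \<times> {0..T}) (\<lambda>(x, t). w x t)"
        using w by (simp add: parabolic_solution_def)
      then have "continuous_on ({0..1} \<times> {0..T}) (\<lambda>p. c0 + c1 * snd p + s * (\<lambda>(x, t). w x t) p)"
        by (intro continuous_intros)
      then show "continuous_on ({0..1} \<times> {0..T}) (\<lambda>(x, t). c0 + c1 * t + s * w x t)"
        by (simp add: case_prod_unfold)
    next
      fix x t :: real assume xt: "x \<in> {0..1}" "t \<in> {0..T}"
      have d: "(w x has_real_derivative wt x t) (at t within {0..T})"
        "((\<lambda>y. w y t) has_real_derivative wx x t) (at x within {0..1})"
        "((\<lambda>y. wx y t) has_real_derivative wxx x t) (at x within {0..1})"
        and e: "wt x t - \<epsilon> * wxx x t + b x t * w x t = G x t"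
        using w xt unfolding parabolic_solution_def by auto
      show "((\<lambda>t. c0 + c1 * t + s * w x t) has_real_derivative c1 + s * wt x t) (at t within {0..T})"
        "((\<lambda>y. c0 + c1 * t + s * w y t) has_real_derivative s * wx x t) (at x within {0..1})"
        "((\<lambda>y. s * wx y t) has_real_derivative s * wxx x t) (at x within {0..1})"
        using d by (auto intro!: derivative_eq_intros)
      show "c1 + s * wt x t - \<epsilon> * (s * wxx x t) + b x t * (c0 + c1 * t + s * w x t) = ?G x t"
        unfolding e[symmetric] by (simp add: algebra_simps)
    next
      fix t assume t: "t \<in> {0..T}"
      have e: "w 0 t - \<kappa> * wx 0 t = \<psi>0 t" "w 1 t + \<kappa> * wx 1 t = \<psi>1 t"
        using w t unfolding parabolic_solution_def by auto
      show "c0 + c1 * t + s * w 0 t - \<kappa> * (s * wx 0 t) = ?\<psi> \<psi>0 t"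
        "c0 + c1 * t + s * w 1 t + \<kappa> * (s * wx 1 t) = ?\<psi> \<psi>1 t"
        unfolding e[symmetric] by (simp_all add: algebra_simps)
    qed
    then show ?thesis
    proof (rule parabolic_minimum_principle[OF _ T \<epsilon> \<kappa> _ _ _ _ x t])
      fix x t :: real assume xt: "x \<in> {0..1}" "t \<in> {0..T}"
      show "0 < b x t" using b[OF xt] \<alpha> by linarith
      have "\<alpha> * c0 \<le> b x t * (c0 + c1 * t)"
        using b[OF xt] c xt \<alpha> by (intro mult_mono) auto
      then show "0 \<le> ?G x t" using G[OF xt] s by auto
    next
      fix t assume t: "t \<in> {0..T}"
      show "0 \<le> ?\<psi> \<psi>0 t \<and> 0 \<le> ?\<psi> \<psi>1 t" using \<psi>[OF t] s by auto
    next
      fix x :: real assume x: "x \<in> {0..1}"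
      show "0 \<le> c0 + c1 * 0 + s * w x 0" using init[OF x] s by auto
    qed
  qed
  from this[of 1] this[of "-1"] show ?thesis by auto
qed

text \<open>
  A barrier linear in \<open>t\<close> controls \<open>w x t - w x 0\<close>; hence the time shift \<open>w x (t + h) - w x t\<close>
  solves a problem of the same kind with source, boundary and initial data of order \<open>h\<close>.
\<close>

lemma parabolic_time_lipschitz:
  assumes w: "parabolic_solution T \<epsilon> \<kappa> b G \<psi>0 \<psi>1 w wt wx wxx"
    and \<epsilon>: "0 < \<epsilon>" and \<kappa>: "0 \<le> \<kappa>" and \<alpha>: "0 < \<alpha>"
    and nn: "0 \<le> A" "0 \<le> A'" "0 \<le> W" "0 \<le> P" "0 \<le> D"
    and b: "\<And>x t. x \<in> {0..1} \<Longrightarrow> t \<in> {0..T} \<Longrightarrow> \<alpha> \<le> b x t"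
    and G: "\<And>x s t. x \<in> {0..1} \<Longrightarrow> s \<in> {0..T} \<Longrightarrow> t \<in> {0..T} \<Longrightarrow> \<bar>G x s - G x t\<bar> \<le> A * \<bar>s - t\<bar>"
    and b': "\<And>x s t. x \<in> {0..1} \<Longrightarrow> s \<in> {0..T} \<Longrightarrow> t \<in> {0..T} \<Longrightarrow> \<bar>b x s - b x t\<bar> \<le> A' * \<bar>s - t\<bar>"
    and W: "\<And>x t. x \<in> {0..1} \<Longrightarrow> t \<in> {0..T} \<Longrightarrow> \<bar>w x t\<bar> \<le> W"
    and \<psi>0: "\<And>s t. s \<in> {0..T} \<Longrightarrow> t \<in> {0..T} \<Longrightarrow> \<bar>\<psi>0 s - \<psi>0 t\<bar> \<le> P * \<bar>s - t\<bar>"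
    and \<psi>1: "\<And>s t. s \<in> {0..T} \<Longrightarrow> t \<in> {0..T} \<Longrightarrow> \<bar>\<psi>1 s - \<psi>1 t\<bar> \<le> P * \<bar>s - t\<bar>"
    and D: "\<And>x t. x \<in> {0..1} \<Longrightarrow> t \<in> {0..T} \<Longrightarrow> \<bar>G x t + \<epsilon> * wxx x 0 - b x t * w x 0\<bar> \<le> D"
    and x: "x \<in> {0..1}" and s: "s \<in> {0..T}" and t: "t \<in> {0..T}"
  shows "\<bar>w x s - w x t\<bar> \<le> ((A + A' * W) / \<alpha> + 2 * P + D) * \<bar>s - t\<bar>"
proof -
  \<comment> \<open>Three demands on the time shift: the source divided by \<alpha>, the boundary
    data \<open>P\<close>, and the initial data \<open>P + D\<close> supplied by the first barrier.
    The sum serves in place of the maximum.\<close>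
  let ?C = "(A + A' * W) / \<alpha> + 2 * P + D"
  have cw: "continuous_on ({0..1} \<times> {0..T}) (\<lambda>p. w (fst p) (snd p))"
    using w by (simp add: parabolic_solution_def case_prod_unfold)
  have dw: "(w x has_real_derivative wt x t) (at t within {0..T})"
      "((\<lambda>y. w y t) has_real_derivative wx x t) (at x within {0..1})"
      "((\<lambda>y. wx y t) has_real_derivative wxx x t) (at x within {0..1})"
      "wt x t = G x t + \<epsilon> * wxx x t - b x t * w x t"
    if "x \<in> {0..1}" "t \<in> {0..T}" for x t
    using w that unfolding parabolic_solution_def by (auto simp: algebra_simps)
  have bw: "w 0 t - \<kappa> * wx 0 t = \<psi>0 t" "w 1 t + \<kappa> * wx 1 t = \<psi>1 t" if "t \<in> {0..T}" for t
    using w that unfolding parabolic_solution_def by auto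
  have T0: "0 \<le> T" "0 \<in> {0..T}" using t by auto
  have init: "\<bar>w x t - w x 0\<bar> \<le> 0 + (P + D) * t" if x: "x \<in> {0..1}" and t: "t \<in> {0..T}" for x t
  proof (rule parabolic_barrier[OF _ T0(1) \<epsilon> \<kappa> \<alpha> _ _ b _ _ _ x t])
    show "parabolic_solution T \<epsilon> \<kappa> b (\<lambda>x t. G x t + \<epsilon> * wxx x 0 - b x t * w x 0)
        (\<lambda>t. \<psi>0 t - \<psi>0 0) (\<lambda>t. \<psi>1 t - \<psi>1 0) (\<lambda>x t. w x t - w x 0) wt
        (\<lambda>x t. wx x t - wx x 0) (\<lambda>x t. wxx x t - wxx x 0)"
      unfolding parabolic_solution_def
    proof (intro conjI ballI)
      have "continuous_on ({0..1} \<times> {0..T}) (\<lambda>p. w (fst (fst p, 0::real)) (snd (fst p, 0::real)))"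
        using T0 by (intro continuous_on_compose2[OF cw] continuous_intros) auto
      then show "continuous_on ({0..1} \<times> {0..T}) (\<lambda>(x, t). w x t - w x 0)"
        using cw by (simp add: case_prod_unfold continuous_on_diff)
    next
      fix x t :: real assume xt: "x \<in> {0..1}" "t \<in> {0..T}"
      note d = dw[OF xt] dw[OF xt(1) T0(2)]
      show "((\<lambda>t. w x t - w x 0) has_real_derivative wt x t) (at t within {0..T})"
        "((\<lambda>y. w y t - w y 0) has_real_derivative wx x t - wx x 0) (at x within {0..1})"
        "((\<lambda>y. wx y t - wx y 0) has_real_derivative wxx x t - wxx x 0) (at x within {0..1})"
        using d by (auto intro!: derivative_eq_intros)
      show "wt x t - \<epsilon> * (wxx x t - wxx x 0) + b x t * (w x t - w x 0)
          = G x t + \<epsilon> * wxx x 0 - b x t * w x 0"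
        unfolding d(4) by (simp add: algebra_simps)
    next
      fix t assume t: "t \<in> {0..T}"
      show "w 0 t - w 0 0 - \<kappa> * (wx 0 t - wx 0 0) = \<psi>0 t - \<psi>0 0"
        "w 1 t - w 1 0 + \<kappa> * (wx 1 t - wx 1 0) = \<psi>1 t - \<psi>1 0"
        using bw[OF t] bw[OF T0(2)] by (simp_all add: algebra_simps)
    qed
  next
    fix x t :: real assume xt: "x \<in> {0..1}" "t \<in> {0..T}"
    show "\<bar>G x t + \<epsilon> * wxx x 0 - b x t * w x 0\<bar> \<le> P + D + \<alpha> * 0"
      using D[OF xt] nn by simp
  next
    fix t assume t: "t \<in> {0..T}"
    have "0 \<le> D * t" using nn t by simp
    then show "\<bar>\<psi>0 t - \<psi>0 0\<bar> \<le> 0 + (P + D) * t \<and> \<bar>\<psi>1 t - \<psi>1 0\<bar> \<le> 0 + (P + D) * t"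
      using \<psi>0[OF t T0(2)] \<psi>1[OF t T0(2)] t by (simp add: distrib_right)
  qed (use nn in auto)
  have forward: "\<bar>w x (t + h) - w x t\<bar> \<le> ?C * h"
    if x: "x \<in> {0..1}" and t: "0 \<le> t" and h: "0 \<le> h" and th: "t + h \<le> T" for x t h
  proof -
    have "\<bar>w x (t + h) - w x t\<bar> \<le> ?C * h + 0 * t"
    proof (rule parabolic_barrier[where T = "T - h" and \<epsilon> = \<epsilon> and \<kappa> = \<kappa> and \<alpha> = \<alpha>
          and w = "\<lambda>x t. w x (t + h) - w x t" and ?c0.0 = "?C * h" and ?c1.0 = 0 and x = x and t = t])
      \<comment> \<open>The time interval shrinks to keep \<open>t + h\<close> inside. As
        \<open>b\<close> depends on time, its increment times \<open>w\<close> is moved to the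
        source, where it costs \<open>A' * W\<close>.\<close>
      show "parabolic_solution (T - h) \<epsilon> \<kappa> (\<lambda>x t. b x (t + h))
          (\<lambda>x t. G x (t + h) - G x t - (b x (t + h) - b x t) * w x t)
          (\<lambda>t. \<psi>0 (t + h) - \<psi>0 t) (\<lambda>t. \<psi>1 (t + h) - \<psi>1 t) (\<lambda>x t. w x (t + h) - w x t)
          (\<lambda>x t. wt x (t + h) - wt x t) (\<lambda>x t. wx x (t + h) - wx x t) (\<lambda>x t. wxx x (t + h) - wxx x t)"
        unfolding parabolic_solution_def
      proof (intro conjI ballI)
        have "continuous_on ({0..1} \<times> {0..T - h}) (\<lambda>p. w (fst (fst p, snd p + h)) (snd (fst p, snd p + h)))"
          using h by (intro continuous_on_compose2[OF cw] continuous_intros) auto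
        moreover have "continuous_on ({0..1} \<times> {0..T - h}) (\<lambda>p. w (fst p) (snd p))"
          using h by (intro continuous_on_subset[OF cw]) auto
        ultimately show "continuous_on ({0..1} \<times> {0..T - h}) (\<lambda>(x, t). w x (t + h) - w x t)"
          by (simp add: case_prod_unfold continuous_on_diff)
      next
        fix x t :: real assume x: "x \<in> {0..1}" and t: "t \<in> {0..T - h}"
        have t': "t \<in> {0..T}" "t + h \<in> {0..T}" using t h by auto
        note d = dw[OF x t'(1)] dw[OF x t'(2)]
        have "((\<lambda>s. w x (s + h)) has_real_derivative wt x (t + h) * 1) (at t within {0..T - h})"
        proof (rule DERIV_image_chain[where f = "w x" and g = "\<lambda>s. s + h", unfolded o_def])
          show "(w x has_real_derivative wt x (t + h)) (at (t + h) within (\<lambda>s. s + h) ` {0..T - h})"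
            using d(5) by (rule DERIV_subset) (use h in auto)
        qed (auto intro!: derivative_eq_intros)
        moreover have "(w x has_real_derivative wt x t) (at t within {0..T - h})"
          using d(1) by (rule DERIV_subset) (use h in auto)
        ultimately show "((\<lambda>t. w x (t + h) - w x t) has_real_derivative wt x (t + h) - wt x t)
            (at t within {0..T - h})"
          by (auto intro!: derivative_eq_intros)
        show "((\<lambda>y. w y (t + h) - w y t) has_real_derivative wx x (t + h) - wx x t) (at x within {0..1})"
          "((\<lambda>y. wx y (t + h) - wx y t) has_real_derivative wxx x (t + h) - wxx x t) (at x within {0..1})"
          using d by (auto intro!: derivative_eq_intros)
        show "wt x (t + h) - wt x t - \<epsilon> * (wxx x (t + h) - wxx x t) + b x (t + h) * (w x (t + h) - w x t)
            = G x (t + h) - G x t - (b x (t + h) - b x t) * w x t"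
          unfolding d(4) d(8) by (simp add: algebra_simps)
      next
        fix t assume t: "t \<in> {0..T - h}"
        then have t': "t \<in> {0..T}" "t + h \<in> {0..T}" using h by auto
        show "w 0 (t + h) - w 0 t - \<kappa> * (wx 0 (t + h) - wx 0 t) = \<psi>0 (t + h) - \<psi>0 t"
          "w 1 (t + h) - w 1 t + \<kappa> * (wx 1 (t + h) - wx 1 t) = \<psi>1 (t + h) - \<psi>1 t"
          using bw[OF t'(1)] bw[OF t'(2)] by (simp_all add: algebra_simps)
      qed
      show "0 \<le> T - h" "0 < \<epsilon>" "0 \<le> \<kappa>" "0 < \<alpha>" "0 \<le> (0::real)" "t \<in> {0..T - h}"
        using t th \<epsilon> \<kappa> \<alpha> by auto
      show "0 \<le> ?C * h" using nn \<alpha> h by simp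
      show "x \<in> {0..1}" by (rule x)
    next
      fix x t :: real assume x: "x \<in> {0..1}" and t: "t \<in> {0..T - h}"
      then have t': "t \<in> {0..T}" "t + h \<in> {0..T}" using h by auto
      show "\<alpha> \<le> b x (t + h)" by (rule b[OF x t'(2)])
      have "\<bar>(b x (t + h) - b x t) * w x t\<bar> \<le> A' * \<bar>t + h - t\<bar> * W"
        unfolding abs_mult using b'[OF x t'(2,1)] W[OF x t'(1)] nn by (intro mult_mono) auto
      then have "\<bar>G x (t + h) - G x t - (b x (t + h) - b x t) * w x t\<bar> \<le> (A + A' * W) * h"
        using G[OF x t'(2,1)] h by (simp add: algebra_simps)
      also have "\<dots> \<le> (A + A' * W) * h + \<alpha> * (2 * P + D) * h"
        using \<alpha> h nn by simp
      also have "\<dots> = \<alpha> * (?C * h)"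
        using \<alpha> by (simp add: field_simps)
      finally show "\<bar>G x (t + h) - G x t - (b x (t + h) - b x t) * w x t\<bar> \<le> 0 + \<alpha> * (?C * h)" by simp
    next
      fix t assume t: "t \<in> {0..T - h}"
      then have t': "t \<in> {0..T}" "t + h \<in> {0..T}" using h by auto
      have "P * h \<le> ?C * h" using nn \<alpha> h by (intro mult_right_mono) auto
      then show "\<bar>\<psi>0 (t + h) - \<psi>0 t\<bar> \<le> ?C * h + 0 * t \<and> \<bar>\<psi>1 (t + h) - \<psi>1 t\<bar> \<le> ?C * h + 0 * t"
        using \<psi>0[OF t'(2,1)] \<psi>1[OF t'(2,1)] h by simp
    next
      fix x :: real assume x: "x \<in> {0..1}"
      have "(P + D) * h \<le> ?C * h" using nn \<alpha> h by (intro mult_right_mono) auto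
      then show "\<bar>w x (0 + h) - w x 0\<bar> \<le> ?C * h" using init[OF x, of h] h th t by simp
    qed
    then show ?thesis by simp
  qed
  show ?thesis
    using forward[OF x, of s "t - s"] forward[OF x, of t "s - t"] s t
    by (cases "s \<le> t") (auto simp: abs_minus_commute)
qed

section \<open>Bounds uniform in the perturbation parameter\<close>

text \<open>The device for differentiating identities: equation, boundary and initial conditions are
  known on closed intervals only, and agreement there already determines the one-sided derivatives
  at the ends.\<close>

lemma derivative_unique_Icc:
  fixes g h :: "real \<Rightarrow> real"
  assumes "p < q" "x \<in> {p..q}"
    and g: "(g has_real_derivative D) (at x within {p..q})"
    and h: "(h has_real_derivative E) (at x within {p..q})"
    and eq: "\<And>y. y \<in> {p..q} \<Longrightarrow> g y = h y"
  shows "D = E"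
proof -
  have "(g has_real_derivative E) (at x within {p..q})"
    using h assms(2) eq unfolding has_field_derivative_def by (metis has_derivative_transform)
  then show ?thesis
    using vector_derivative_unique_within_closed_interval[of p q x g D E] assms(1,2) g
    by (simp add: has_real_derivative_iff_has_vector_derivative)
qed

lemma differentiable_imp_deriv_on:
  assumes "g differentiable (at x within {p..q})"
  shows "(g has_real_derivative deriv_on p q g x) (at x within {p..q})"
  using assms unfolding deriv_on_def has_real_derivative_iff_has_vector_derivative
  by (simp add: vector_derivative_works)

lemma class_C_has_derivative:
  assumes "class_C n p q g" "i < n" "x \<in> {p..q}"
  shows "((deriv_on p q ^^ i) g has_real_derivative (deriv_on p q ^^ Suc i) g x) (at x within {p..q})"
  using assms differentiable_imp_deriv_on by (auto simp: class_C_def)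

lemma class_C_bounded:
  assumes "class_C n p q g"
  obtains B where "\<And>i x. i \<le> n \<Longrightarrow> x \<in> {p..q} \<Longrightarrow> \<bar>(deriv_on p q ^^ i) g x\<bar> \<le> B"
proof -
  have "bounded (\<Union>i\<in>{..n}. (deriv_on p q ^^ i) g ` {p..q})"
    using assms by (intro bounded_UN ballI compact_imp_bounded compact_continuous_image)
      (auto simp: class_C_def)
  then show ?thesis using that unfolding bounded_iff by fastforce
qed

lemma partial_00 [simp]: "partial T 0 0 w = w"
  by (simp add: partial_def)

lemma partial_has_dx:
  assumes "continuous_partial T (Suc i) j w" "x \<in> {0..1}" "t \<in> {0..T}"
  shows "((\<lambda>y. partial T i j w y t) has_real_derivative partial T (Suc i) j w x t) (at x within {0..1})"
proof -
  have "partial T (Suc i) j w x t = deriv_on 0 1 (\<lambda>y. partial T i j w y t) x"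
    by (simp add: partial_def dx_def)
  then show ?thesis
    using assms differentiable_imp_deriv_on[of "\<lambda>y. partial T i j w y t" x 0 1]
    by (simp add: continuous_partial_def)
qed

lemma partial_has_dt:
  assumes "continuous_partial T 0 (Suc j) w" "x \<in> {0..1}" "t \<in> {0..T}"
  shows "(partial T 0 j w x has_real_derivative partial T 0 (Suc j) w x t) (at t within {0..T})"
proof -
  have "partial T 0 (Suc j) w x t = deriv_on 0 T (partial T 0 j w x) t"
    by (simp add: partial_def dt_def)
  then show ?thesis
    using assms differentiable_imp_deriv_on[of "partial T 0 j w x" t 0 T]
    by (simp add: continuous_partial_def)
qed

lemma class_C_rect_bounded:
  assumes "class_C_rect k T w"
  obtains B where "\<And>i j x t. i + j \<le> k \<Longrightarrow> x \<in> {0..1} \<Longrightarrow> t \<in> {0..T} \<Longrightarrow> \<bar>partial T i j w x t\<bar> \<le> B"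
proof -
  have "bounded (\<Union>(i, j)\<in>{(i, j). i + j \<le> k}. (\<lambda>(x, t). partial T i j w x t) ` ({0..1} \<times> {0..T}))"
  proof (intro bounded_UN ballI, goal_cases)
    case 1
    have "{(i, j). i + j \<le> k} \<subseteq> {..k} \<times> {..k}" by auto
    then show ?case by (rule finite_subset) simp
  next
    case (2 ij)
    then show ?case using assms
      by (auto simp: class_C_rect_def continuous_partial_def simp del: image_split_eq_Sigma
          intro!: compact_imp_bounded compact_continuous_image compact_Times)
  qed
  then obtain B where B: "\<And>v. v \<in> (\<Union>(i, j)\<in>{(i, j). i + j \<le> k}.
      (\<lambda>(x, t). partial T i j w x t) ` ({0..1} \<times> {0..T})) \<Longrightarrow> norm v \<le> B"
    unfolding bounded_iff by blast
  show ?thesis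
  proof (rule that)
    fix i j :: nat and x t :: real assume "i + j \<le> k" "x \<in> {0..1}" "t \<in> {0..T}"
    then show "\<bar>partial T i j w x t\<bar> \<le> B"
      by (intro B[unfolded real_norm_def] UN_I[of "(i, j)"]) (auto intro!: image_eqI[of _ _ "(x, t)"])
  qed
qed

lemma lipschitz_Icc:
  fixes g :: "real \<Rightarrow> real"
  assumes "\<And>y. y \<in> {p..q} \<Longrightarrow> (g has_real_derivative g' y) (at y within {p..q})"
    and "\<And>y. y \<in> {p..q} \<Longrightarrow> \<bar>g' y\<bar> \<le> B"
    and "s \<in> {p..q}" "t \<in> {p..q}"
  shows "\<bar>g s - g t\<bar> \<le> B * \<bar>s - t\<bar>"
  using field_differentiable_bound[of "{p..q}" g g' B s t] assms by simp

lemma product_lipschitz: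
  fixes b b' u u' :: real
  assumes "\<bar>b - b'\<bar> \<le> A * d" "\<bar>u - u'\<bar> \<le> C * d" "\<bar>b\<bar> \<le> B" "\<bar>u'\<bar> \<le> W"
  shows "\<bar>b * u - b' * u'\<bar> \<le> (B * C + A * W) * d"
proof -
  have "b * u - b' * u' = b * (u - u') + (b - b') * u'"
    by (simp add: algebra_simps)
  moreover have "\<bar>b * (u - u')\<bar> \<le> B * (C * d)" "\<bar>(b - b') * u'\<bar> \<le> (A * d) * W"
    unfolding abs_mult using assms by (intro mult_mono; simp)+
  ultimately show ?thesis by (simp add: algebra_simps)
qed

lemma abs_mult_le: "\<bar>a\<bar> \<le> A \<Longrightarrow> \<bar>b\<bar> \<le> B \<Longrightarrow> \<bar>a * b\<bar> \<le> A * (B::real)"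
  unfolding abs_mult by (intro mult_mono) auto

text \<open>Neither \<epsilon> nor \<open>u\<close> occurs here, so the constants built from
  \<open>B\<close> in this locale are fixed before \<epsilon> is chosen. This is how uniformity in
  \<epsilon> is secured.\<close>

locale parabolic_data =
  fixes T \<alpha> :: real and a f :: "real \<Rightarrow> real \<Rightarrow> real" and \<phi>L \<phi>R \<phi>B :: "real \<Rightarrow> real" and B :: real
  assumes T: "0 < T" and \<alpha>: "0 < \<alpha>"
    and a_lower: "\<And>x t. x \<in> {0..1} \<Longrightarrow> t \<in> {0..T} \<Longrightarrow> \<alpha> \<le> a x t"
    and a_smooth: "class_C_rect 2 T a" and f_smooth: "class_C_rect 2 T f"
    and \<phi>L_smooth: "class_C 2 0 T \<phi>L" and \<phi>R_smooth: "class_C 2 0 T \<phi>R"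
    and \<phi>B_smooth: "class_C 5 0 1 \<phi>B"
    and a_bound: "\<And>i j x t. i + j \<le> 2 \<Longrightarrow> x \<in> {0..1} \<Longrightarrow> t \<in> {0..T} \<Longrightarrow> \<bar>partial T i j a x t\<bar> \<le> B"
    and f_bound: "\<And>i j x t. i + j \<le> 2 \<Longrightarrow> x \<in> {0..1} \<Longrightarrow> t \<in> {0..T} \<Longrightarrow> \<bar>partial T i j f x t\<bar> \<le> B"
    and \<phi>L_bound: "\<And>i t. i \<le> 2 \<Longrightarrow> t \<in> {0..T} \<Longrightarrow> \<bar>(deriv_on 0 T ^^ i) \<phi>L t\<bar> \<le> B"
    and \<phi>R_bound: "\<And>i t. i \<le> 2 \<Longrightarrow> t \<in> {0..T} \<Longrightarrow> \<bar>(deriv_on 0 T ^^ i) \<phi>R t\<bar> \<le> B"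
    and \<phi>B_bound: "\<And>i x. i \<le> 5 \<Longrightarrow> x \<in> {0..1} \<Longrightarrow> \<bar>(deriv_on 0 1 ^^ i) \<phi>B x\<bar> \<le> B"
begin

text \<open>
  The last constant bounds \<open>\<epsilon> * \<bar>u\<^sub>x\<^sub>x\<^sub>x\<bar>\<close>, the others the derivative that they are named after,
  for every \<open>\<epsilon> \<in> (0,1]\<close>.
\<close>

definition "u_bound = B / \<alpha> + B"
definition "ut_bound = (B + B * u_bound) / \<alpha> + 2 * B + (2 * B + B * B)"
definition "utt_bound = ((B + (B * ut_bound + B * u_bound)) + B * ut_bound) / \<alpha> + 2 * B +
  (3 * B + 4 * (B * B) + B * u_bound + B * ut_bound)"
definition "ux_bound = (B + B * u_bound) / \<alpha> + (u_bound + B)"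
definition "uxt_bound = ((B + (B * ut_bound + B * u_bound)) + B * ux_bound) / \<alpha> +
  2 * (ut_bound + B) + (2 * B + B * B + B * u_bound)"
definition "uxxx_bound = uxt_bound + B * ux_bound + B + B * u_bound"

lemma B_nonneg: "0 \<le> B"
  using \<phi>L_bound[of 0 0] T by simp

lemma bounds_nonneg: "0 \<le> u_bound" "0 \<le> ut_bound" "0 \<le> utt_bound" "0 \<le> ux_bound" "0 \<le> uxt_bound"
  "0 \<le> uxxx_bound"
proof -
  note nn = add_nonneg_nonneg mult_nonneg_nonneg divide_nonneg_pos B_nonneg \<alpha>
  show u: "0 \<le> u_bound" unfolding u_bound_def by (intro nn)
  show ut: "0 \<le> ut_bound" unfolding ut_bound_def by (intro nn u) auto
  show "0 \<le> utt_bound" unfolding utt_bound_def by (intro nn u ut) auto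
  show ux: "0 \<le> ux_bound" unfolding ux_bound_def by (intro nn u)
  show uxt: "0 \<le> uxt_bound" unfolding uxt_bound_def by (intro nn u ut ux) auto
  show "0 \<le> uxxx_bound" unfolding uxxx_bound_def by (intro nn u ux uxt)
qed

lemmas a_partial = a_smooth[unfolded class_C_rect_def, rule_format]
lemmas f_partial = f_smooth[unfolded class_C_rect_def, rule_format]

lemma mixed_dt:
  assumes w: "class_C_rect 2 T w" and x: "x \<in> {0..1}" and t: "t \<in> {0..T}"
  shows "(partial T 1 0 w x has_real_derivative partial T 1 1 w x t) (at t within {0..T})"
proof (rule schwarz_rectangle[where w = w and v = "partial T 0 1 w" and wx = "partial T 1 0 w"
      and vx = "partial T 1 1 w", OF T _ _ _ _ x t])
  note c = w[unfolded class_C_rect_def, rule_format]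
  fix x t :: real assume "x \<in> {0..1}" "t \<in> {0..T}"
  then show "(w x has_real_derivative partial T 0 1 w x t) (at t within {0..T})"
    "((\<lambda>y. w y t) has_real_derivative partial T 1 0 w x t) (at x within {0..1})"
    "((\<lambda>y. partial T 0 1 w y t) has_real_derivative partial T 1 1 w x t) (at x within {0..1})"
    using partial_has_dt[of T 0 w x t] partial_has_dx[of T 0 0 w x t] partial_has_dx[of T 0 1 w x t] c
    by simp_all
next
  note c = w[unfolded class_C_rect_def, rule_format]
  show "continuous_on ({0..1} \<times> {0..T}) (\<lambda>(x, t). partial T 1 1 w x t)"
    using c[of 1 1] by (simp add: continuous_partial_def)
qed

lemma dt_lipschitz:
  assumes w: "class_C_rect 2 T w"
    and b: "\<And>i j x t. i + j \<le> 2 \<Longrightarrow> x \<in> {0..1} \<Longrightarrow> t \<in> {0..T} \<Longrightarrow> \<bar>partial T i j w x t\<bar> \<le> B"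
    and xst: "x \<in> {0..1}" "s \<in> {0..T}" "t \<in> {0..T}"
  shows "\<bar>w x s - w x t\<bar> \<le> B * \<bar>s - t\<bar>"
    "\<bar>partial T 0 1 w x s - partial T 0 1 w x t\<bar> \<le> B * \<bar>s - t\<bar>"
    "\<bar>partial T 1 0 w x s - partial T 1 0 w x t\<bar> \<le> B * \<bar>s - t\<bar>"
proof -
  note c = w[unfolded class_C_rect_def, rule_format]
  have d: "(w x has_real_derivative partial T 0 1 w x r) (at r within {0..T})"
    "(partial T 0 1 w x has_real_derivative partial T 0 2 w x r) (at r within {0..T})"
    if "r \<in> {0..T}" for r
    using partial_has_dt[of T 0 w x r] partial_has_dt[of T 1 w x r] c xst that
    by (simp_all add: numeral_2_eq_2)
  show "\<bar>w x s - w x t\<bar> \<le> B * \<bar>s - t\<bar>"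
    by (rule lipschitz_Icc[OF d(1) _ xst(2,3)]) (use b[of 0 1] xst in auto)
  show "\<bar>partial T 0 1 w x s - partial T 0 1 w x t\<bar> \<le> B * \<bar>s - t\<bar>"
    by (rule lipschitz_Icc[OF d(2) _ xst(2,3)]) (use b[of 0 2] xst in auto)
  show "\<bar>partial T 1 0 w x s - partial T 1 0 w x t\<bar> \<le> B * \<bar>s - t\<bar>"
    by (rule lipschitz_Icc[OF mixed_dt[OF w xst(1)] _ xst(2,3)]) (use b[of 1 1] xst in auto)
qed

lemmas a_lipschitz = dt_lipschitz[OF a_smooth a_bound]
lemmas f_lipschitz = dt_lipschitz[OF f_smooth f_bound]

lemma \<phi>_deriv:
  assumes "t \<in> {0..T}"
  shows "(\<phi>L has_real_derivative deriv_on 0 T \<phi>L t) (at t within {0..T})"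
    "(\<phi>R has_real_derivative deriv_on 0 T \<phi>R t) (at t within {0..T})"
    "(deriv_on 0 T \<phi>L has_real_derivative (deriv_on 0 T ^^ 2) \<phi>L t) (at t within {0..T})"
    "(deriv_on 0 T \<phi>R has_real_derivative (deriv_on 0 T ^^ 2) \<phi>R t) (at t within {0..T})"
  using class_C_has_derivative[OF \<phi>L_smooth, of 0 t] class_C_has_derivative[OF \<phi>L_smooth, of 1 t]
    class_C_has_derivative[OF \<phi>R_smooth, of 0 t] class_C_has_derivative[OF \<phi>R_smooth, of 1 t] assms
  by (simp_all add: numeral_2_eq_2)

lemma \<phi>_lipschitz:
  assumes st: "s \<in> {0..T}" "t \<in> {0..T}"
  shows "\<bar>\<phi>L s - \<phi>L t\<bar> \<le> B * \<bar>s - t\<bar>" "\<bar>\<phi>R s - \<phi>R t\<bar> \<le> B * \<bar>s - t\<bar>"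
    "\<bar>deriv_on 0 T \<phi>L s - deriv_on 0 T \<phi>L t\<bar> \<le> B * \<bar>s - t\<bar>"
    "\<bar>deriv_on 0 T \<phi>R s - deriv_on 0 T \<phi>R t\<bar> \<le> B * \<bar>s - t\<bar>"
  by (rule lipschitz_Icc[OF \<phi>_deriv(1) _ st] lipschitz_Icc[OF \<phi>_deriv(2) _ st]
      lipschitz_Icc[OF \<phi>_deriv(3) _ st] lipschitz_Icc[OF \<phi>_deriv(4) _ st];
      use \<phi>L_bound[of 1] \<phi>R_bound[of 1] \<phi>L_bound[of 2] \<phi>R_bound[of 2] in auto)+

lemma \<phi>B_deriv:
  assumes "i < 5" "x \<in> {0..1}"
  shows "((deriv_on 0 1 ^^ i) \<phi>B has_real_derivative (deriv_on 0 1 ^^ Suc i) \<phi>B x) (at x within {0..1})"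
  by (rule class_C_has_derivative[OF \<phi>B_smooth assms])

end

section \<open>The problems solved by \<open>u\<close>, \<open>u_t\<close> and
  \<open>u_x\<close>\<close>

locale parabolic_problem = parabolic_data +
  fixes \<epsilon> :: real and u :: "real \<Rightarrow> real \<Rightarrow> real"
  assumes \<epsilon>: "0 < \<epsilon>" "\<epsilon> \<le> 1"
    and solution: "continuous_solution T \<epsilon> a f \<phi>L \<phi>R \<phi>B u"
begin

abbreviation D where "D i j \<equiv> partial T i j u"

lemma u_partial: "i + 2 * j \<le> 4 \<Longrightarrow> continuous_partial T i j u"
  using solution by (simp add: continuous_solution_def)

lemma D_continuous: "i + 2 * j \<le> 4 \<Longrightarrow> continuous_on ({0..1} \<times> {0..T}) (\<lambda>(x, t). D i j x t)"
  using u_partial by (simp add: continuous_partial_def)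

lemma D_dx:
  assumes "x \<in> {0..1}" "t \<in> {0..T}" "Suc i + 2 * j \<le> 4"
  shows "((\<lambda>y. D i j y t) has_real_derivative D (Suc i) j x t) (at x within {0..1})"
  by (rule partial_has_dx[OF u_partial]) (use assms in auto)

lemma D_dt0:
  assumes "x \<in> {0..1}" "t \<in> {0..T}" "j \<le> 1"
  shows "(D 0 j x has_real_derivative D 0 (Suc j) x t) (at t within {0..T})"
  by (rule partial_has_dt[OF u_partial]) (use assms in auto)

text \<open>\<open>D i 1\<close> has the time derivative innermost; repeated exchange of order, one
  \<open>x\<close>-derivative at a time, moves it outside. This reaches \<open>i = 2\<close>, since
  \<open>D 2 1\<close> is the highest \<open>D i 1\<close> known to be continuous.\<close>

lemma D_dt:
  assumes x: "x \<in> {0..1}" and t: "t \<in> {0..T}" and i: "i \<le> 2"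
  shows "(D i 0 x has_real_derivative D i 1 x t) (at t within {0..T})"
proof -
  have 1: "(D (Suc i) 0 x has_real_derivative D (Suc i) 1 x t) (at t within {0..T})"
    if x: "x \<in> {0..1}" and t: "t \<in> {0..T}" and i: "i \<le> 1"
      and D: "\<And>x t. x \<in> {0..1} \<Longrightarrow> t \<in> {0..T} \<Longrightarrow> (D i 0 x has_real_derivative D i 1 x t) (at t within {0..T})"
    for i x t
  proof (rule schwarz_rectangle[where w = "D i 0" and v = "D i 1" and wx = "D (Suc i) 0" and vx = "D (Suc i) 1", OF T D _ _ _ x t])
    show "continuous_on ({0..1} \<times> {0..T}) (\<lambda>(x, t). D (Suc i) 1 x t)"
      using i by (intro D_continuous) simp
  qed (use D_dx i in auto)
  have 0: "(D 0 0 x has_real_derivative D 0 1 x t) (at t within {0..T})"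
    if "x \<in> {0..1}" "t \<in> {0..T}" for x t
    using D_dt0[OF that, of 0] by simp
  have 2: "(D (Suc 0) 0 x has_real_derivative D (Suc 0) 1 x t) (at t within {0..T})"
    if "x \<in> {0..1}" "t \<in> {0..T}" for x t
    by (rule 1[OF that _ 0]) auto
  have 3: "(D (Suc (Suc 0)) 0 x has_real_derivative D (Suc (Suc 0)) 1 x t) (at t within {0..T})"
    by (rule 1[OF x t _ 2]) auto
  from i consider "i = 0" | "i = Suc 0" | "i = Suc (Suc 0)" by linarith
  then show ?thesis using 0[OF x t] 2[OF x t] 3 by cases auto
qed

text \<open>The equation is given for \<open>0 < x < 1\<close> and \<open>0 < t\<close>; continuity
  carries it to the closure. The sides are needed to differentiate it up to the boundary, the
  initial line to compute time derivatives at \<open>t = 0\<close>.\<close>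

lemma pde:
  assumes "x \<in> {0..1}" "t \<in> {0..T}"
  shows "D 0 1 x t = f x t - a x t * u x t + \<epsilon> * D 2 0 x t"
proof -
  have cl: "closure ({0<..<1} \<times> {0<..T}) = {0..1::real} \<times> {0..T}"
    using T by (simp add: closure_Times)
  have "(\<lambda>(x, t). D 0 1 x t - \<epsilon> * D 2 0 x t + a x t * D 0 0 x t - f x t) (x, t) = 0"
  proof (rule continuous_constant_on_closure[where S = "{0<..<1} \<times> {0<..T}"
        and f = "\<lambda>(x, t). D 0 1 x t - \<epsilon> * D 2 0 x t + a x t * D 0 0 x t - f x t"])
    have "continuous_on ({0..1} \<times> {0..T}) (\<lambda>(x, t). a x t)" "continuous_on ({0..1} \<times> {0..T}) (\<lambda>(x, t). f x t)"
      using a_partial[of 0 0] f_partial[of 0 0] by (simp_all add: continuous_partial_def)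
    with D_continuous[of 0 1] D_continuous[of 2 0] D_continuous[of 0 0]
    show "continuous_on (closure ({0<..<1} \<times> {0<..T})) (\<lambda>(x, t). D 0 1 x t - \<epsilon> * D 2 0 x t + a x t * D 0 0 x t - f x t)"
      unfolding cl case_prod_unfold by (intro continuous_intros) auto
    fix p :: "real \<times> real" assume "p \<in> {0<..<1} \<times> {0<..T}"
    then show "(\<lambda>(x, t). D 0 1 x t - \<epsilon> * D 2 0 x t + a x t * D 0 0 x t - f x t) p = 0"
      using solution by (auto simp: continuous_solution_def)
  qed (use cl assms in auto)
  then show ?thesis by simp
qed

lemma boundary:
  assumes "t \<in> {0..T}"
  shows "u 0 t - D 1 0 0 t = \<phi>L t" "u 1 t + D 1 0 1 t = \<phi>R t"
  using solution assms by (auto simp: continuous_solution_def)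

lemma initial: "x \<in> {0..1} \<Longrightarrow> u x 0 = \<phi>B x"
  using solution by (auto simp: continuous_solution_def)

lemma solution_u: "parabolic_solution T \<epsilon> 1 a f \<phi>L \<phi>R u (D 0 1) (D 1 0) (D 2 0)"
  unfolding parabolic_solution_def
proof (intro conjI ballI)
  show "continuous_on ({0..1} \<times> {0..T}) (\<lambda>(x, t). u x t)"
    using D_continuous[of 0 0] by simp
  fix x t :: real assume xt: "x \<in> {0..1}" "t \<in> {0..T}"
  show "(u x has_real_derivative D 0 1 x t) (at t within {0..T})"
    "((\<lambda>y. u y t) has_real_derivative D 1 0 x t) (at x within {0..1})"
    "((\<lambda>y. D 1 0 y t) has_real_derivative D 2 0 x t) (at x within {0..1})"
    using D_dt0[OF xt, of 0] D_dx[OF xt, of 0 0] D_dx[OF xt, of 1 0] by (simp_all add: numeral_2_eq_2)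
  show "D 0 1 x t - \<epsilon> * D 2 0 x t + a x t * u x t = f x t" using pde[OF xt] by simp
qed (use boundary in auto)

text \<open>Equation and Robin conditions are differentiated in time. The product of
  \<open>u\<close> with the time derivative of \<open>a\<close> goes to the source, so the operator
  and its barriers stay the same.\<close>

lemma solution_ut:
  "parabolic_solution T \<epsilon> 1 a (\<lambda>x t. partial T 0 1 f x t - partial T 0 1 a x t * u x t)
     (deriv_on 0 T \<phi>L) (deriv_on 0 T \<phi>R) (D 0 1) (D 0 2) (D 1 1) (D 2 1)"
  unfolding parabolic_solution_def
proof (intro conjI ballI)
  show "continuous_on ({0..1} \<times> {0..T}) (\<lambda>(x, t). D 0 1 x t)"
    using D_continuous[of 0 1] by simp
  fix x t :: real assume xt: "x \<in> {0..1}" "t \<in> {0..T}"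
  show tt: "(D 0 1 x has_real_derivative D 0 2 x t) (at t within {0..T})"
    and "((\<lambda>y. D 0 1 y t) has_real_derivative D 1 1 x t) (at x within {0..1})"
    "((\<lambda>y. D 1 1 y t) has_real_derivative D 2 1 x t) (at x within {0..1})"
    using D_dt0[OF xt, of 1] D_dx[OF xt, of 0 1] D_dx[OF xt, of 1 1] by (simp_all add: numeral_2_eq_2)
  have "D 0 2 x t = partial T 0 1 f x t - (partial T 0 1 a x t * u x t + D 0 1 x t * a x t) + \<epsilon> * D 2 1 x t"
  proof (rule derivative_unique_Icc[OF T xt(2) tt])
    have "(a x has_real_derivative partial T 0 1 a x t) (at t within {0..T})"
      "(f x has_real_derivative partial T 0 1 f x t) (at t within {0..T})"
      "(u x has_real_derivative D 0 1 x t) (at t within {0..T})"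
      using partial_has_dt[of T 0 _ x t] a_partial[of 0 1] f_partial[of 0 1] u_partial[of 0 1] xt by auto
    then show "((\<lambda>s. f x s - a x s * u x s + \<epsilon> * D 2 0 x s) has_real_derivative
        partial T 0 1 f x t - (partial T 0 1 a x t * u x t + D 0 1 x t * a x t) + \<epsilon> * D 2 1 x t) (at t within {0..T})"
      using D_dt[OF xt, of 2] by (intro derivative_intros DERIV_cmult) auto
  qed (use pde xt in auto)
  then show "D 0 2 x t - \<epsilon> * D 2 1 x t + a x t * D 0 1 x t
      = partial T 0 1 f x t - partial T 0 1 a x t * u x t" by simp
next
  fix t assume t: "t \<in> {0..T}"
  have d: "(u x has_real_derivative D 0 1 x t) (at t within {0..T})"
    "(D 1 0 x has_real_derivative D 1 1 x t) (at t within {0..T})" if "x \<in> {0..1}" for x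
    using D_dt[OF that t, of 0] D_dt[OF that t, of 1] by simp_all
  have "((\<lambda>t. u 0 t - D 1 0 0 t) has_real_derivative D 0 1 0 t - D 1 1 0 t) (at t within {0..T})"
    by (intro derivative_intros d) auto
  then have "D 0 1 0 t - D 1 1 0 t = deriv_on 0 T \<phi>L t"
    by (rule derivative_unique_Icc[OF T t _ \<phi>_deriv(1)[OF t]]) (use boundary in auto)
  then show "D 0 1 0 t - 1 * D 1 1 0 t = deriv_on 0 T \<phi>L t" by simp
  have "((\<lambda>t. u 1 t + D 1 0 1 t) has_real_derivative D 0 1 1 t + D 1 1 1 t) (at t within {0..T})"
    by (intro derivative_intros d) auto
  then have "D 0 1 1 t + D 1 1 1 t = deriv_on 0 T \<phi>R t"
    by (rule derivative_unique_Icc[OF T t _ \<phi>_deriv(2)[OF t]]) (use boundary in auto)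
  then show "D 0 1 1 t + 1 * D 1 1 1 t = deriv_on 0 T \<phi>R t" by simp
qed

text \<open>The equation is differentiated in \<open>x\<close>. The Robin conditions, solved for
  \<open>u_x\<close>, become Dirichlet data involving only \<open>u\<close>, \<open>\<phi>L\<close>
  and \<open>\<phi>R\<close>; hence \<open>\<kappa> = 0\<close>.\<close>

lemma solution_ux:
  "parabolic_solution T \<epsilon> 0 a (\<lambda>x t. partial T 1 0 f x t - partial T 1 0 a x t * u x t)
     (\<lambda>t. u 0 t - \<phi>L t) (\<lambda>t. \<phi>R t - u 1 t) (D 1 0) (D 1 1) (D 2 0) (D 3 0)"
  unfolding parabolic_solution_def
proof (intro conjI ballI)
  show "continuous_on ({0..1} \<times> {0..T}) (\<lambda>(x, t). D 1 0 x t)"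
    using D_continuous[of 1 0] by simp
  fix x t :: real assume xt: "x \<in> {0..1}" "t \<in> {0..T}"
  show "(D 1 0 x has_real_derivative D 1 1 x t) (at t within {0..T})" by (rule D_dt[OF xt]) simp
  show "((\<lambda>y. D 1 0 y t) has_real_derivative D 2 0 x t) (at x within {0..1})"
    and xxx: "((\<lambda>y. D 2 0 y t) has_real_derivative D 3 0 x t) (at x within {0..1})"
    using D_dx[OF xt, of 1 0] D_dx[OF xt, of 2 0] by (simp_all add: numeral_2_eq_2 numeral_3_eq_3)
  have xt1: "((\<lambda>y. D 0 1 y t) has_real_derivative D 1 1 x t) (at x within {0..1})"
    using D_dx[OF xt, of 0 1] by simp
  have "D 1 1 x t = partial T 1 0 f x t - (partial T 1 0 a x t * u x t + D 1 0 x t * a x t) + \<epsilon> * D 3 0 x t"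
  proof (rule derivative_unique_Icc[OF _ xt(1) xt1])
    have "((\<lambda>y. a y t) has_real_derivative partial T 1 0 a x t) (at x within {0..1})"
      "((\<lambda>y. f y t) has_real_derivative partial T 1 0 f x t) (at x within {0..1})"
      "((\<lambda>y. u y t) has_real_derivative D 1 0 x t) (at x within {0..1})"
      using partial_has_dx[of T 0 0 _ x t] a_partial[of 1 0] f_partial[of 1 0] u_partial[of 1 0] xt by auto
    then show "((\<lambda>y. f y t - a y t * u y t + \<epsilon> * D 2 0 y t) has_real_derivative
        partial T 1 0 f x t - (partial T 1 0 a x t * u x t + D 1 0 x t * a x t) + \<epsilon> * D 3 0 x t) (at x within {0..1})"
      using xxx by (intro derivative_intros DERIV_cmult) auto
  qed (use pde xt in auto)
  then show "D 1 1 x t - \<epsilon> * D 3 0 x t + a x t * D 1 0 x t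
      = partial T 1 0 f x t - partial T 1 0 a x t * u x t" by simp
next
  fix t assume t: "t \<in> {0..T}"
  show "D 1 0 0 t - 0 * D 2 0 0 t = u 0 t - \<phi>L t" "D 1 0 1 t + 0 * D 2 0 1 t = \<phi>R t - u 1 t"
    using boundary[OF t] by simp_all
qed

lemma initial_derivatives:
  assumes x: "x \<in> {0..1}" and i: "i \<le> 4"
  shows "D i 0 x 0 = (deriv_on 0 1 ^^ i) \<phi>B x"
  using x i
proof (induction i arbitrary: x)
  case 0
  then show ?case using initial by simp
next
  case (Suc i)
  show ?case
    by (rule derivative_unique_Icc[OF _ Suc.prems(1) D_dx \<phi>B_deriv]) (use Suc T in auto)
qed

text \<open>Two \<open>x\<close>-derivatives of the equation at \<open>t = 0\<close>. The time-shift
  estimate for \<open>u_t\<close> needs \<epsilon> times this quantity to be bounded by the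
  data.\<close>

lemma initial_ut_xx:
  assumes x: "x \<in> {0..1}"
  shows "D 2 1 x 0 = partial T 2 0 f x 0 - (partial T 2 0 a x 0 * \<phi>B x
    + 2 * (partial T 1 0 a x 0 * deriv_on 0 1 \<phi>B x) + a x 0 * (deriv_on 0 1 ^^ 2) \<phi>B x)
    + \<epsilon> * (deriv_on 0 1 ^^ 4) \<phi>B x"
proof -
  let ?\<phi> = "\<lambda>i. (deriv_on 0 1 ^^ i) \<phi>B"
  have T0: "0 \<in> {0..T}" using T by simp
  have da: "((\<lambda>y. a y 0) has_real_derivative partial T 1 0 a x 0) (at x within {0..1})"
    "((\<lambda>y. partial T 1 0 a y 0) has_real_derivative partial T 2 0 a x 0) (at x within {0..1})"
    if "x \<in> {0..1}" for x
    using partial_has_dx[of T 0 0 a x 0] partial_has_dx[of T 1 0 a x 0] a_partial[of 1 0] a_partial[of 2 0] that T0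
    by (simp_all add: numeral_2_eq_2)
  have df: "((\<lambda>y. f y 0) has_real_derivative partial T 1 0 f x 0) (at x within {0..1})"
    "((\<lambda>y. partial T 1 0 f y 0) has_real_derivative partial T 2 0 f x 0) (at x within {0..1})"
    if "x \<in> {0..1}" for x
    using partial_has_dx[of T 0 0 f x 0] partial_has_dx[of T 1 0 f x 0] f_partial[of 1 0] f_partial[of 2 0] that T0
    by (simp_all add: numeral_2_eq_2)
  have d\<phi>: "(?\<phi> 0 has_real_derivative ?\<phi> 1 x) (at x within {0..1})"
    "(?\<phi> 1 has_real_derivative ?\<phi> 2 x) (at x within {0..1})"
    "(?\<phi> 2 has_real_derivative ?\<phi> 3 x) (at x within {0..1})"
    "(?\<phi> 3 has_real_derivative ?\<phi> 4 x) (at x within {0..1})"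
    if "x \<in> {0..1}" for x
    using \<phi>B_deriv[OF _ that, of 0] \<phi>B_deriv[OF _ that, of 1] \<phi>B_deriv[OF _ that, of 2] \<phi>B_deriv[OF _ that, of 3]
    by (simp_all add: eval_nat_numeral)
  have v0: "D 0 1 y 0 = f y 0 - a y 0 * ?\<phi> 0 y + \<epsilon> * ?\<phi> 2 y" if "y \<in> {0..1}" for y
    using pde[OF that T0] initial_derivatives[OF that, of 2] initial[OF that] by simp
  have v1: "D 1 1 y 0 = partial T 1 0 f y 0 - (partial T 1 0 a y 0 * ?\<phi> 0 y + ?\<phi> 1 y * a y 0) + \<epsilon> * ?\<phi> 3 y"
    if y: "y \<in> {0..1}" for y
  proof (rule derivative_unique_Icc[OF _ y])
    show "((\<lambda>y. D 0 1 y 0) has_real_derivative D 1 1 y 0) (at y within {0..1})"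
      using D_dx[OF y T0, of 0 1] by simp
    show "((\<lambda>y. f y 0 - a y 0 * ?\<phi> 0 y + \<epsilon> * ?\<phi> 2 y) has_real_derivative
        partial T 1 0 f y 0 - (partial T 1 0 a y 0 * ?\<phi> 0 y + ?\<phi> 1 y * a y 0) + \<epsilon> * ?\<phi> 3 y) (at y within {0..1})"
      by (intro derivative_intros DERIV_cmult da df d\<phi> y)
  qed (use v0 in auto)
  have "D 2 1 x 0 = partial T 2 0 f x 0 - ((partial T 2 0 a x 0 * ?\<phi> 0 x + ?\<phi> 1 x * partial T 1 0 a x 0)
      + (?\<phi> 2 x * a x 0 + partial T 1 0 a x 0 * ?\<phi> 1 x)) + \<epsilon> * ?\<phi> 4 x"
  proof (rule derivative_unique_Icc[OF _ x])
    show "((\<lambda>y. D 1 1 y 0) has_real_derivative D 2 1 x 0) (at x within {0..1})"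
      using D_dx[OF x T0, of 1 1] by (simp add: numeral_2_eq_2)
    show "((\<lambda>y. partial T 1 0 f y 0 - (partial T 1 0 a y 0 * ?\<phi> 0 y + ?\<phi> 1 y * a y 0) + \<epsilon> * ?\<phi> 3 y) has_real_derivative
        partial T 2 0 f x 0 - ((partial T 2 0 a x 0 * ?\<phi> 0 x + ?\<phi> 1 x * partial T 1 0 a x 0)
      + (?\<phi> 2 x * a x 0 + partial T 1 0 a x 0 * ?\<phi> 1 x)) + \<epsilon> * ?\<phi> 4 x) (at x within {0..1})"
      by (intro derivative_intros DERIV_cmult da df d\<phi> x)
  qed (use v1 in auto)
  then show ?thesis by simp
qed

section \<open>A priori estimates with constants independent of \<epsilon>\<close>

lemma abs_\<epsilon>_mult: "\<bar>\<epsilon> * z\<bar> \<le> \<bar>z\<bar>"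
  using \<epsilon> by (simp add: abs_mult mult_left_le_one_le)

text \<open>A constant barrier: the summand \<open>B / \<alpha>\<close> of \<open>u_bound\<close>
  absorbs the source, the summand \<open>B\<close> the boundary and initial values.\<close>

lemma u_le:
  assumes "x \<in> {0..1}" "t \<in> {0..T}"
  shows "\<bar>u x t\<bar> \<le> u_bound"
proof -
  have "\<bar>u x t\<bar> \<le> u_bound + 0 * t"
  proof (rule parabolic_barrier[OF solution_u _ \<epsilon>(1) _ \<alpha> _ _ a_lower _ _ _ assms])
    have le: "B \<le> u_bound" "B \<le> \<alpha> * u_bound" using \<alpha> B_nonneg by (auto simp: u_bound_def field_simps)
    show "\<bar>f x t\<bar> \<le> 0 + \<alpha> * u_bound" if "x \<in> {0..1}" "t \<in> {0..T}" for x t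
      using f_bound[of 0 0, OF _ that] le by simp
    show "\<bar>\<phi>L t\<bar> \<le> u_bound + 0 * t \<and> \<bar>\<phi>R t\<bar> \<le> u_bound + 0 * t" if "t \<in> {0..T}" for t
      using \<phi>L_bound[of 0, OF _ that] \<phi>R_bound[of 0, OF _ that] le by simp
    show "\<bar>u x 0\<bar> \<le> u_bound" if "x \<in> {0..1}" for x
      using \<phi>B_bound[of 0, OF _ that] initial[OF that] le by simp
  qed (use T bounds_nonneg in auto)
  then show ?thesis by simp
qed

text \<open>The residual of the initial profile consists of \<open>f\<close>,
  \<open>\<epsilon> * \<phi>B''\<close> and \<open>a * \<phi>B\<close>; with
  \<open>\<epsilon> \<le> 1\<close> it is at most \<open>2 * B + B * B\<close>, the last summand of
  \<open>ut_bound\<close>.\<close>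

lemma u_lipschitz:
  assumes "x \<in> {0..1}" "s \<in> {0..T}" "t \<in> {0..T}"
  shows "\<bar>u x s - u x t\<bar> \<le> ut_bound * \<bar>s - t\<bar>"
  unfolding ut_bound_def
proof (rule parabolic_time_lipschitz[OF solution_u \<epsilon>(1) _ \<alpha> _ _ _ _ _ a_lower
      f_lipschitz(1) a_lipschitz(1) u_le \<phi>_lipschitz(1) \<phi>_lipschitz(2) _ assms])
  fix x t :: real assume xt: "x \<in> {0..1}" "t \<in> {0..T}"
  have "\<bar>a x t * u x 0\<bar> \<le> B * B"
    using a_bound[of 0 0, OF _ xt] \<phi>B_bound[of 0, OF _ xt(1)] initial[OF xt(1)]
    by (intro abs_mult_le) auto
  moreover have "\<bar>\<epsilon> * D 2 0 x 0\<bar> \<le> B"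
    using abs_\<epsilon>_mult[of "D 2 0 x 0"] \<phi>B_bound[of 2, OF _ xt(1)] initial_derivatives[OF xt(1), of 2] by simp
  ultimately show "\<bar>f x t + \<epsilon> * D 2 0 x 0 - a x t * u x 0\<bar> \<le> 2 * B + B * B"
    using f_bound[of 0 0, OF _ xt] by simp
qed (use B_nonneg bounds_nonneg in auto)

lemma ut_le:
  assumes "x \<in> {0..1}" "t \<in> {0..T}"
  shows "\<bar>D 0 1 x t\<bar> \<le> ut_bound"
  by (rule derivative_le_lipschitz[OF T assms(2)])
    (use D_dt0[OF assms, of 0] u_lipschitz assms in auto)

text \<open>Both sources contain \<open>u\<close>, whose Lipschitz constant in time must therefore
  be known first. The index pair lets the problems for \<open>u_t\<close> and \<open>u_x\<close>
  share one estimate.\<close>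

lemma source_lipschitz:
  assumes ij: "i = 0 \<and> j = 1 \<or> i = 1 \<and> j = 0" and xst: "x \<in> {0..1}" "s \<in> {0..T}" "t \<in> {0..T}"
  shows "\<bar>(partial T i j f x s - partial T i j a x s * u x s) - (partial T i j f x t - partial T i j a x t * u x t)\<bar>
    \<le> (B + (B * ut_bound + B * u_bound)) * \<bar>s - t\<bar>"
proof -
  have "\<bar>partial T i j a x s * u x s - partial T i j a x t * u x t\<bar> \<le> (B * ut_bound + B * u_bound) * \<bar>s - t\<bar>"
    by (rule product_lipschitz[OF _ u_lipschitz[OF xst]])
       (use ij xst a_lipschitz(2,3)[OF _ _ _ xst] a_bound u_le in auto)
  moreover have "\<bar>partial T i j f x s - partial T i j f x t\<bar> \<le> B * \<bar>s - t\<bar>"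
    using ij f_lipschitz(2,3)[OF _ _ _ xst] f_bound by auto
  ultimately show ?thesis by (simp add: distrib_right)
qed

lemma source_le:
  assumes ij: "i + j \<le> 2" and xt: "x \<in> {0..1}" "t \<in> {0..T}"
  shows "\<bar>partial T i j f x t - partial T i j a x t * u x t\<bar> \<le> B + B * u_bound"
  using f_bound[OF ij xt] abs_mult_le[OF a_bound[OF ij xt] u_le[OF xt]] by linarith

lemma ut_lipschitz:
  assumes "x \<in> {0..1}" "s \<in> {0..T}" "t \<in> {0..T}"
  shows "\<bar>D 0 1 x s - D 0 1 x t\<bar> \<le> utt_bound * \<bar>s - t\<bar>"
  unfolding utt_bound_def
proof (rule parabolic_time_lipschitz[OF solution_ut \<epsilon>(1) _ \<alpha> _ _ _ _ _ a_lower
      source_lipschitz a_lipschitz(1) ut_le \<phi>_lipschitz(3) \<phi>_lipschitz(4) _ assms])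
  fix x t :: real assume xt: "x \<in> {0..1}" "t \<in> {0..T}"
  have T0: "0 \<in> {0..T}" using T by simp
  have "\<bar>a x t * D 0 1 x 0\<bar> \<le> B * ut_bound"
    using a_bound[of 0 0, OF _ xt] ut_le[OF xt(1) T0] by (intro abs_mult_le) auto
  \<comment> \<open>Differentiating \<open>a * \<phi>B\<close> twice gives four products, counting
    the factor 2; \<open>f_xx\<close> and \<epsilon> times the fourth derivative of
    \<open>\<phi>B\<close> give \<open>2 * B\<close>.\<close>
  moreover have "\<bar>D 2 1 x 0\<bar> \<le> 2 * B + 4 * (B * B)"
  proof -
    have "\<bar>partial T 2 0 a x 0 * \<phi>B x\<bar> \<le> B * B" "\<bar>partial T 1 0 a x 0 * deriv_on 0 1 \<phi>B x\<bar> \<le> B * B"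
      "\<bar>a x 0 * (deriv_on 0 1 ^^ 2) \<phi>B x\<bar> \<le> B * B"
      using a_bound[OF _ xt(1) T0, of 2 0] a_bound[OF _ xt(1) T0, of 1 0] a_bound[OF _ xt(1) T0, of 0 0]
        \<phi>B_bound[of 0 x] \<phi>B_bound[of 1 x] \<phi>B_bound[of 2 x] xt(1)
      by (auto intro!: abs_mult_le)
    moreover have "\<bar>\<epsilon> * (deriv_on 0 1 ^^ 4) \<phi>B x\<bar> \<le> B"
      using abs_\<epsilon>_mult \<phi>B_bound[of 4, OF _ xt(1)] by (rule order_trans) simp
    moreover have "\<bar>partial T 2 0 f x 0\<bar> \<le> B" using f_bound[OF _ xt(1) T0, of 2 0] by simp
    ultimately show ?thesis unfolding initial_ut_xx[OF xt(1)] by linarith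
  qed
  then have "\<bar>\<epsilon> * D 2 1 x 0\<bar> \<le> 2 * B + 4 * (B * B)"
    using abs_\<epsilon>_mult order_trans by blast
  moreover have "\<bar>partial T 0 1 f x t - partial T 0 1 a x t * u x t\<bar> \<le> B + B * u_bound"
    by (rule source_le) (use xt in auto)
  ultimately show "\<bar>partial T 0 1 f x t - partial T 0 1 a x t * u x t + \<epsilon> * D 2 1 x 0 - a x t * D 0 1 x 0\<bar>
      \<le> 3 * B + 4 * (B * B) + B * u_bound + B * ut_bound" by linarith
qed (use B_nonneg bounds_nonneg in auto)

text \<open>Again a constant barrier: \<open>u_bound + B\<close> dominates the Dirichlet and initial
  data, and the other summand of \<open>ux_bound\<close> is the source bound divided by
  \<alpha>.\<close>

lemma ux_le:
  assumes "x \<in> {0..1}" "t \<in> {0..T}"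
  shows "\<bar>D 1 0 x t\<bar> \<le> ux_bound"
proof -
  have "\<bar>D 1 0 x t\<bar> \<le> ux_bound + 0 * t"
  proof (rule parabolic_barrier[OF solution_ux _ \<epsilon>(1) _ \<alpha> _ _ a_lower _ _ _ assms])
    have "B + B * u_bound \<le> B + B * u_bound + \<alpha> * (u_bound + B)"
      using \<alpha> B_nonneg bounds_nonneg by simp
    also have "\<dots> = \<alpha> * ux_bound" using \<alpha> by (simp add: ux_bound_def field_simps)
    finally have le: "B + B * u_bound \<le> \<alpha> * ux_bound" .
    have le': "u_bound + B \<le> ux_bound" using \<alpha> B_nonneg bounds_nonneg by (simp add: ux_bound_def)
    show "\<bar>partial T 1 0 f x t - partial T 1 0 a x t * u x t\<bar> \<le> 0 + \<alpha> * ux_bound"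
      if "x \<in> {0..1}" "t \<in> {0..T}" for x t
      using source_le[OF _ that, of 1 0] le by simp
    show "\<bar>u 0 t - \<phi>L t\<bar> \<le> ux_bound + 0 * t \<and> \<bar>\<phi>R t - u 1 t\<bar> \<le> ux_bound + 0 * t" if "t \<in> {0..T}" for t
      using \<phi>L_bound[of 0, OF _ that] \<phi>R_bound[of 0, OF _ that] u_le[OF _ that, of 0] u_le[OF _ that, of 1] le'
      by auto
    show "\<bar>D 1 0 x 0\<bar> \<le> ux_bound" if "x \<in> {0..1}" for x
      using \<phi>B_bound[of 1, OF _ that] initial_derivatives[OF that, of 1] le' bounds_nonneg(1) by simp
  qed (use T bounds_nonneg in auto)
  then show ?thesis by simp
qed

text \<open>The Dirichlet data \<open>u - \<phi>L\<close> and \<open>\<phi>R - u\<close> inherit the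
  Lipschitz constant of \<open>u\<close> in time, so \<open>P = ut_bound + B\<close>.\<close>

lemma ux_lipschitz:
  assumes "x \<in> {0..1}" "s \<in> {0..T}" "t \<in> {0..T}"
  shows "\<bar>D 1 0 x s - D 1 0 x t\<bar> \<le> uxt_bound * \<bar>s - t\<bar>"
  unfolding uxt_bound_def
proof (rule parabolic_time_lipschitz[OF solution_ux \<epsilon>(1) _ \<alpha> _ _ _ _ _ a_lower
      source_lipschitz a_lipschitz(1) ux_le _ _ _ assms])
  fix x t :: real assume xt: "x \<in> {0..1}" "t \<in> {0..T}"
  have "\<bar>a x t * D 1 0 x 0\<bar> \<le> B * B"
    using a_bound[of 0 0, OF _ xt] \<phi>B_bound[of 1, OF _ xt(1)] initial_derivatives[OF xt(1), of 1]
    by (intro abs_mult_le) auto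
  moreover have "\<bar>\<epsilon> * D 3 0 x 0\<bar> \<le> B"
    using abs_\<epsilon>_mult[of "D 3 0 x 0"] \<phi>B_bound[of 3, OF _ xt(1)] initial_derivatives[OF xt(1), of 3] by simp
  moreover have "\<bar>partial T 1 0 f x t - partial T 1 0 a x t * u x t\<bar> \<le> B + B * u_bound"
    by (rule source_le) (use xt in auto)
  ultimately show "\<bar>partial T 1 0 f x t - partial T 1 0 a x t * u x t + \<epsilon> * D 3 0 x 0 - a x t * D 1 0 x 0\<bar>
      \<le> 2 * B + B * B + B * u_bound" by linarith
next
  fix s t assume st: "s \<in> {0..T}" "t \<in> {0..T}"
  have "\<bar>u 0 s - u 0 t\<bar> \<le> ut_bound * \<bar>s - t\<bar>" "\<bar>u 1 s - u 1 t\<bar> \<le> ut_bound * \<bar>s - t\<bar>"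
    using u_lipschitz[OF _ st] by simp_all
  with \<phi>_lipschitz(1,2)[OF st]
  show "\<bar>u 0 s - \<phi>L s - (u 0 t - \<phi>L t)\<bar> \<le> (ut_bound + B) * \<bar>s - t\<bar>"
    "\<bar>\<phi>R s - u 1 s - (\<phi>R t - u 1 t)\<bar> \<le> (ut_bound + B) * \<bar>s - t\<bar>"
    unfolding distrib_right by linarith+
qed (use B_nonneg bounds_nonneg in auto)

lemma uxxx_le:
  assumes xt: "x \<in> {0..1}" "t \<in> {0..T}"
  shows "\<epsilon> * \<bar>D 3 0 x t\<bar> \<le> uxxx_bound"
proof -
  \<comment> \<open>The Lipschitz bound on \<open>u_x\<close> is turned into one on
    \<open>u_xt\<close>; every term of the equation for \<open>u_x\<close> except
    \<open>\<epsilon> * u_xxx\<close> is then controlled.\<close>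
  have "\<bar>D 1 1 x t\<bar> \<le> uxt_bound"
    by (rule derivative_le_lipschitz[OF T xt(2) D_dt[OF xt]]) (use ux_lipschitz xt in auto)
  moreover have "\<bar>a x t * D 1 0 x t\<bar> \<le> B * ux_bound"
    using a_bound[of 0 0, OF _ xt] ux_le[OF xt] by (intro abs_mult_le) auto
  moreover have "\<bar>partial T 1 0 f x t - partial T 1 0 a x t * u x t\<bar> \<le> B + B * u_bound"
    by (rule source_le) (use xt in auto)
  moreover have "D 1 1 x t - \<epsilon> * D 3 0 x t + a x t * D 1 0 x t
      = partial T 1 0 f x t - partial T 1 0 a x t * u x t"
    using solution_ux xt by (auto simp: parabolic_solution_def)
  ultimately have "\<bar>\<epsilon> * D 3 0 x t\<bar> \<le> uxxx_bound" unfolding uxxx_bound_def by linarith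
  then show ?thesis using \<epsilon> by (simp add: abs_mult)
qed

lemma uxx_le:
  assumes xt: "x \<in> {0..1}" "t \<in> {0..T}"
  shows "sqrt \<epsilon> * \<bar>D 2 0 x t\<bar> \<le> 4 * ux_bound + uxxx_bound"
proof -
  \<comment> \<open>The step length \<open>d = sqrt \<epsilon>\<close> balances the bounded
    \<open>u_x\<close>, divided by \<open>d\<close>, against \<open>u_xxx\<close> of order
    \<open>1 / \<epsilon>\<close>, multiplied by \<open>d\<close>.\<close>
  have "\<bar>D 2 0 x t\<bar> \<le> 4 * ux_bound / sqrt \<epsilon> + uxxx_bound / \<epsilon> * sqrt \<epsilon>"
  proof (rule landau_derivative_bound[where g = "\<lambda>y. D 1 0 y t" and g' = "\<lambda>y. D 2 0 y t" and g'' = "\<lambda>y. D 3 0 y t"])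
    fix y :: real assume y: "y \<in> {0..1}"
    show "((\<lambda>y. D 1 0 y t) has_real_derivative D 2 0 y t) (at y within {0..1})"
      "((\<lambda>y. D 2 0 y t) has_real_derivative D 3 0 y t) (at y within {0..1})"
      using D_dx[OF y xt(2), of 1 0] D_dx[OF y xt(2), of 2 0] by (simp_all add: numeral_2_eq_2 numeral_3_eq_3)
    show "\<bar>D 1 0 y t\<bar> \<le> ux_bound" by (rule ux_le[OF y xt(2)])
    show "\<bar>D 3 0 y t\<bar> \<le> uxxx_bound / \<epsilon>"
      using uxxx_le[OF y xt(2)] \<epsilon> by (simp add: field_simps)
  qed (use xt \<epsilon> in auto)
  also have "\<dots> = (4 * ux_bound + uxxx_bound) / sqrt \<epsilon>"
    using \<epsilon> real_sqrt_mult_self[of \<epsilon>] by (simp add: field_simps)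
  finally show ?thesis using \<epsilon> by (simp add: field_simps)
qed

end

section \<open>The discrete problem\<close>

text \<open>The signs at a negative minimum as in the continuous case: the forward
  \<open>x\<close>-quotient is nonnegative and the backward one nonpositive, so
  \<open>delta_x2\<close> is nonnegative, and the backward time quotient is nonpositive. Any
  strictly increasing mesh will do.\<close>

lemma discrete_minimum_principle:
  fixes X \<tau> :: "nat \<Rightarrow> real" and E b :: "nat \<Rightarrow> nat \<Rightarrow> real"
  assumes N: "1 \<le> N" and X: "\<And>j. j < N \<Longrightarrow> X j < X (Suc j)" and \<tau>: "\<And>k. k < M \<Longrightarrow> \<tau> k < \<tau> (Suc k)"
    and \<epsilon>: "0 \<le> \<epsilon>" and b: "\<And>j k. j \<in> {1..N-1} \<Longrightarrow> k \<in> {1..M} \<Longrightarrow> 0 < b j k"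
    and int: "\<And>j k. j \<in> {1..N-1} \<Longrightarrow> k \<in> {1..M} \<Longrightarrow>
        0 \<le> Dt_minus \<tau> E j k - \<epsilon> * delta_x2 X E j k + b j k * E j k"
    and left: "\<And>k. k \<in> {1..M} \<Longrightarrow> 0 \<le> E 0 k - Dx_plus X E 0 k"
    and right: "\<And>k. k \<in> {1..M} \<Longrightarrow> 0 \<le> E N k + Dx_minus X E N k"
    and init: "\<And>j. j \<le> N \<Longrightarrow> 0 \<le> E j 0"
    and j: "j \<le> N" and k: "k \<le> M"
  shows "0 \<le> E j k"
proof (rule ccontr)
  assume neg: "\<not> 0 \<le> E j k"
  define S where "S = (\<lambda>(j, k). E j k) ` ({..N} \<times> {..M})"
  have S: "finite S" "S \<noteq> {}" by (auto simp: S_def)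
  obtain i l where il: "i \<le> N" "l \<le> M" "E i l = Min S"
  proof -
    have "\<forall>v\<in>S. \<exists>i\<le>N. \<exists>l\<le>M. E i l = v" by (auto simp: S_def)
    then show ?thesis using Min_in[OF S] that by blast
  qed
  have min: "E i l \<le> E j k" if "j \<le> N" "k \<le> M" for j k
    unfolding il(3) by (rule Min_le[OF S(1)]) (use that in \<open>auto simp: S_def intro!: image_eqI[of _ _ "(j, k)"]\<close>)
  have lt: "E i l < 0" using min[OF j k] neg by simp
  have l: "l \<in> {1..M}" using init[OF il(1)] lt il by (cases l) auto
  consider "i = 0" | "i = N" | "i \<in> {1..N-1}" using il N by fastforce
  then show False
  proof cases
    case 1
    have "0 \<le> Dx_plus X E 0 l"
      using min[of 1 l] X[of 0] N il 1 by (simp add: Dx_plus_def)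
    then show False using left[OF l] lt 1 by simp
  next
    case 2
    have "Dx_minus X E N l \<le> 0"
      using min[of "N - 1" l] X[of "N - 1"] N il 2 by (simp add: Dx_minus_def divide_le_0_iff)
    then show False using right[OF l] lt 2 by simp
  next
    case 3
    then have i: "i < N" "i - 1 < N" "Suc (i - 1) = i" by auto
    have lk: "l - 1 < M" "Suc (l - 1) = l" using l by auto
    have "Dt_minus \<tau> E i l \<le> 0"
      using min[of i "l - 1"] \<tau>[OF lk(1)] lk il by (simp add: Dt_minus_def divide_le_0_iff)
    moreover have "0 \<le> Dx_plus X E i l" "Dx_minus X E i l \<le> 0"
      using min[of "i + 1" l] min[of "i - 1" l] X[OF i(1)] X[OF i(2)] i il
      by (simp_all add: Dx_plus_def Dx_minus_def divide_le_0_iff)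
    then have "0 \<le> delta_x2 X E i l"
      using X[OF i(1)] X[OF i(2)] i by (simp add: delta_x2_def)
    moreover have "b i l * E i l < 0" using b[OF 3 l] lt by (simp add: mult_pos_neg)
    ultimately show False using int[OF 3 l] \<epsilon> by (smt (verit) mult_nonneg_nonneg)
  qed
qed

lemma difference_affine:
  "Dt_minus \<tau> (\<lambda>j k. c + s * E j k) j k = s * Dt_minus \<tau> E j k"
  "Dx_plus X (\<lambda>j k. c + s * E j k) j k = s * Dx_plus X E j k"
  "Dx_minus X (\<lambda>j k. c + s * E j k) j k = s * Dx_minus X E j k"
  "delta_x2 X (\<lambda>j k. c + s * E j k) j k = s * delta_x2 X E j k"
  by (simp_all add: Dt_minus_def Dx_plus_def Dx_minus_def delta_x2_def algebra_simps diff_divide_distrib)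

lemma difference_minus:
  "Dt_minus \<tau> (\<lambda>j k. E j k - F j k) j k = Dt_minus \<tau> E j k - Dt_minus \<tau> F j k"
  "Dx_plus X (\<lambda>j k. E j k - F j k) j k = Dx_plus X E j k - Dx_plus X F j k"
  "Dx_minus X (\<lambda>j k. E j k - F j k) j k = Dx_minus X E j k - Dx_minus X F j k"
  "delta_x2 X (\<lambda>j k. E j k - F j k) j k = delta_x2 X E j k - delta_x2 X F j k"
  by (simp_all add: Dt_minus_def Dx_plus_def Dx_minus_def delta_x2_def algebra_simps diff_divide_distrib add_divide_distrib)

text \<open>The constant barrier \<open>c\<close> passes unchanged through the boundary rows and
  yields at least \<open>\<alpha> * c\<close> in the interior rows. So interior residuals get
  divided by \<alpha>, boundary residuals do not.\<close>

lemma discrete_stability: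
  fixes X \<tau> :: "nat \<Rightarrow> real" and E b :: "nat \<Rightarrow> nat \<Rightarrow> real"
  assumes N: "1 \<le> N" and X: "\<And>j. j < N \<Longrightarrow> X j < X (Suc j)" and \<tau>: "\<And>k. k < M \<Longrightarrow> \<tau> k < \<tau> (Suc k)"
    and \<epsilon>: "0 \<le> \<epsilon>" and \<alpha>: "0 < \<alpha>" and c: "0 \<le> c"
    and b: "\<And>j k. j \<in> {1..N-1} \<Longrightarrow> k \<in> {1..M} \<Longrightarrow> \<alpha> \<le> b j k"
    and int: "\<And>j k. j \<in> {1..N-1} \<Longrightarrow> k \<in> {1..M} \<Longrightarrow>
        \<bar>Dt_minus \<tau> E j k - \<epsilon> * delta_x2 X E j k + b j k * E j k\<bar> \<le> \<alpha> * c"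
    and left: "\<And>k. k \<in> {1..M} \<Longrightarrow> \<bar>E 0 k - Dx_plus X E 0 k\<bar> \<le> c"
    and right: "\<And>k. k \<in> {1..M} \<Longrightarrow> \<bar>E N k + Dx_minus X E N k\<bar> \<le> c"
    and init: "\<And>j. j \<le> N \<Longrightarrow> \<bar>E j 0\<bar> \<le> c"
    and j: "j \<le> N" and k: "k \<le> M"
  shows "\<bar>E j k\<bar> \<le> c"
proof -
  have "0 \<le> c + s * E j k" if s: "s = 1 \<or> s = -1" for s
  proof (rule discrete_minimum_principle[where E = "\<lambda>j k. c + s * E j k" and b = b and X = X and \<tau> = \<tau>,
        OF N X \<tau> \<epsilon> _ _ _ _ _ j k])
    fix j k assume jk: "j \<in> {1..N-1}" "k \<in> {1..M}"
    show "0 < b j k" using b[OF jk] \<alpha> by simp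
    have "\<alpha> * c \<le> b j k * c" using b[OF jk] c by (intro mult_right_mono)
    then show "0 \<le> Dt_minus \<tau> (\<lambda>j k. c + s * E j k) j k - \<epsilon> * delta_x2 X (\<lambda>j k. c + s * E j k) j k
        + b j k * (c + s * E j k)"
      unfolding difference_affine using int[OF jk] s by (auto simp: distrib_left)
  next
    fix k assume k: "k \<in> {1..M}"
    show "0 \<le> c + s * E 0 k - Dx_plus X (\<lambda>j k. c + s * E j k) 0 k"
      "0 \<le> c + s * E N k + Dx_minus X (\<lambda>j k. c + s * E j k) N k"
      unfolding difference_affine using left[OF k] right[OF k] s by auto
  next
    fix j assume j: "j \<le> N"
    show "0 \<le> c + s * E j 0" using init[OF j] s by auto
  qed auto
  from this[of 1] this[of "-1"] show ?thesis by auto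
qed

section \<open>Truncation errors of the difference quotients\<close>

text \<open>The linear Taylor polynomial at \<open>x\<close> is subtracted. A Lipschitz condition on
  \<open>g'\<close> replaces a bound on the second derivative, matching the form of the estimate for
  \<open>u_t\<close>; \<open>s\<close> may lie on either side of \<open>x\<close>, which covers
  forward and backward quotients.\<close>

lemma difference_quotient_error:
  fixes g g' :: "real \<Rightarrow> real"
  assumes g: "\<And>y. y \<in> {p..q} \<Longrightarrow> (g has_real_derivative g' y) (at y within {p..q})"
    and lip: "\<And>y. y \<in> {p..q} \<Longrightarrow> \<bar>g' y - g' x\<bar> \<le> B * \<bar>y - x\<bar>"
    and B: "0 \<le> B" and x: "x \<in> {p..q}" and s: "s \<in> {p..q}" "s \<noteq> x"
  shows "\<bar>(g s - g x) / (s - x) - g' x\<bar> \<le> B * \<bar>s - x\<bar>"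
proof -
  have "\<bar>(g s - g' x * s) - (g x - g' x * x)\<bar> \<le> B * \<bar>s - x\<bar> ^ Suc 1"
    by (rule derivative_growth_bound[of "{p..q}" _ _ _ _ "\<lambda>y. g' y - g' x"])
       (use s x B lip in \<open>auto intro!: derivative_eq_intros g\<close>)
  moreover have "(g s - g' x * s) - (g x - g' x * x) = ((g s - g x) / (s - x) - g' x) * (s - x)"
    using s by (simp add: field_simps)
  ultimately have "\<bar>(g s - g x) / (s - x) - g' x\<bar> * \<bar>s - x\<bar> \<le> (B * \<bar>s - x\<bar>) * \<bar>s - x\<bar>"
    by (simp add: abs_mult mult_ac)
  then show ?thesis using s by (simp add: mult_le_cancel_right)
qed

text \<open>Taylor expansion on both sides of \<open>x\<close>: the terms with \<open>g' x\<close>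
  cancel, those with \<open>g'' x\<close> combine exactly for any two widths. On unequal widths the
  cubic remainders need not cancel, hence first order.\<close>

lemma second_difference_error:
  fixes g g' g'' g''' :: "real \<Rightarrow> real"
  assumes g: "\<And>y. y \<in> {p..q} \<Longrightarrow> (g has_real_derivative g' y) (at y within {p..q})"
    and g': "\<And>y. y \<in> {p..q} \<Longrightarrow> (g' has_real_derivative g'' y) (at y within {p..q})"
    and g'': "\<And>y. y \<in> {p..q} \<Longrightarrow> (g'' has_real_derivative g''' y) (at y within {p..q})"
    and B: "\<And>y. y \<in> {p..q} \<Longrightarrow> \<bar>g''' y\<bar> \<le> B"
    and x: "x \<in> {p..q}" and l: "l \<in> {p..q}" "l < x" and r: "r \<in> {p..q}" "x < r"
  shows "\<bar>2 / (r - l) * ((g r - g x) / (r - x) - (g x - g l) / (x - l)) - g'' x\<bar> \<le> 2 * B * (r - l)"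
proof -
  have B0: "0 \<le> B" using B[OF x] by linarith
  \<comment> \<open>The growth bound is used three times, starting from \<open>g'''\<close>; the
    constant is \<open>B\<close> rather than the \<open>B / 6\<close> of the sharp
    remainder.\<close>
  have t: "\<bar>(g s - g x) / (s - x) - g' x - g'' x / 2 * (s - x)\<bar> \<le> B * (s - x)\<^sup>2"
    if s: "s \<in> {p..q}" "s \<noteq> x" for s
  proof -
    have 1: "\<bar>g'' y - g'' x\<bar> \<le> B * \<bar>y - x\<bar> ^ Suc 0" if "y \<in> {p..q}" for y
      by (rule derivative_growth_bound[of "{p..q}" _ _ _ _ g''']) (use that x B0 B g'' in auto)
    have 2: "\<bar>(g' y - g'' x * (y - x)) - (g' x - g'' x * (x - x))\<bar> \<le> B * \<bar>y - x\<bar> ^ Suc (Suc 0)"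
      if "y \<in> {p..q}" for y
      by (rule derivative_growth_bound[of "{p..q}" _ _ _ _ "\<lambda>y. g'' y - g'' x"])
         (use that x B0 1 in \<open>auto intro!: derivative_eq_intros g'\<close>)
    have 3: "((\<lambda>s. g s - g' x * s - g'' x / 2 * (s - x)\<^sup>2) has_real_derivative
        g' y - g'' x * (y - x) - g' x) (at y within {p..q})" if "y \<in> {p..q}" for y
      by (rule derivative_eq_intros refl g that | simp add: field_simps)+
    have "\<bar>(g s - g' x * s - g'' x / 2 * (s - x)\<^sup>2) - (g x - g' x * x - g'' x / 2 * (x - x)\<^sup>2)\<bar>
        \<le> B * \<bar>s - x\<bar> ^ Suc (Suc (Suc 0))"
      by (rule derivative_growth_bound[of "{p..q}" _ _ _ _ "\<lambda>y. g' y - g'' x * (y - x) - g' x"])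
         (use s x B0 2 3 in auto)
    moreover have "(g s - g' x * s - g'' x / 2 * (s - x)\<^sup>2) - (g x - g' x * x - g'' x / 2 * (x - x)\<^sup>2)
        = ((g s - g x) / (s - x) - g' x - g'' x / 2 * (s - x)) * (s - x)"
      using s by (simp add: field_simps power2_eq_square)
    moreover have "B * \<bar>s - x\<bar> ^ Suc (Suc (Suc 0)) = B * (s - x)\<^sup>2 * \<bar>s - x\<bar>"
      by (simp add: power2_eq_square abs_mult_self_eq)
    ultimately show ?thesis using s by (simp add: abs_mult mult_le_cancel_right power2_eq_square)
  qed
  define R where "R = (g r - g x) / (r - x) - g' x - g'' x / 2 * (r - x)"
  define L where "L = (g l - g x) / (l - x) - g' x - g'' x / 2 * (l - x)"
  have "\<bar>R\<bar> \<le> B * (r - x)\<^sup>2" "\<bar>L\<bar> \<le> B * (l - x)\<^sup>2" using t[of r] t[of l] l r by (auto simp: R_def L_def)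
  moreover have "(r - x)\<^sup>2 + (l - x)\<^sup>2 \<le> (r - l)\<^sup>2"
  proof -
    have "(r - l)\<^sup>2 - ((r - x)\<^sup>2 + (l - x)\<^sup>2) = 2 * ((r - x) * (x - l))"
      by (simp add: power2_eq_square algebra_simps)
    moreover have "0 \<le> (r - x) * (x - l)" using l r by simp
    ultimately show ?thesis by linarith
  qed
  then have "B * (r - x)\<^sup>2 + B * (l - x)\<^sup>2 \<le> B * (r - l)\<^sup>2"
    using B0 by (metis distrib_left mult_left_mono)
  ultimately have "\<bar>R - L\<bar> \<le> B * (r - l)\<^sup>2" by linarith
  moreover have "2 / (r - l) * ((g r - g x) / (r - x) - (g x - g l) / (x - l)) - g'' x = 2 / (r - l) * (R - L)"
  proof -
    have "(g l - g x) / (l - x) = (g x - g l) / (x - l)"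
      by (metis minus_diff_eq minus_divide_divide)
    then have "R - L = (g r - g x) / (r - x) - (g x - g l) / (x - l) - g'' x / 2 * (r - l)"
      by (simp add: R_def L_def field_simps)
    then have "2 / (r - l) * (R - L) = 2 / (r - l) * ((g r - g x) / (r - x) - (g x - g l) / (x - l))
        - 2 / (r - l) * (g'' x / 2 * (r - l))"
      by (simp only: right_diff_distrib)
    moreover have "2 / (r - l) * (g'' x / 2 * (r - l)) = g'' x" using l r by simp
    ultimately show ?thesis by linarith
  qed
  ultimately have "\<bar>2 / (r - l) * ((g r - g x) / (r - x) - (g x - g l) / (x - l)) - g'' x\<bar>
      \<le> 2 / (r - l) * (B * (r - l)\<^sup>2)"
    using l r by (simp add: abs_mult divide_right_mono)
  also have "\<dots> = 2 * B * (r - l)" using l r by (simp add: power2_eq_square)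
  finally show ?thesis .
qed

section \<open>Geometry of the Shishkin mesh\<close>

lemma shishkin_sigma_bounds:
  assumes "0 < \<epsilon>" "0 < \<alpha>" "2 \<le> N"
  shows "0 < shishkin_sigma \<alpha> \<epsilon> N" "shishkin_sigma \<alpha> \<epsilon> N \<le> 1/4"
    "shishkin_sigma \<alpha> \<epsilon> N \<le> 2 * (sqrt \<epsilon> / sqrt \<alpha>) * ln (real N)"
  using assms by (auto simp: shishkin_sigma_def)

lemma mesh_x_step:
  assumes "0 < \<epsilon>" "0 < \<alpha>" and N: "N = 4 * m" "2 \<le> m" and j: "j < N"
  shows "mesh_x \<alpha> \<epsilon> N (Suc j) - mesh_x \<alpha> \<epsilon> N j =
    (if m \<le> j \<and> j < 3 * m then (1 - 2 * shishkin_sigma \<alpha> \<epsilon> N) / (2 * real m)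
     else shishkin_sigma \<alpha> \<epsilon> N / real m)"
proof -
  define h1 where "h1 = shishkin_sigma \<alpha> \<epsilon> N / real m"
  define h2 where "h2 = (1 - 2 * shishkin_sigma \<alpha> \<epsilon> N) / (2 * real m)"
  have \<sigma>: "shishkin_sigma \<alpha> \<epsilon> N = real m * h1" "1 - 2 * (real m * h1) = 2 * real m * h2"
    using N by (auto simp: h1_def h2_def)
  have X: "mesh_x \<alpha> \<epsilon> N i =
    (if i \<le> m then real i * h1 else if i \<le> 3 * m then real m * h1 + (real i - real m) * h2
     else 1 - real m * h1 + (real i - 3 * real m) * h1)" for i
  proof -
    have "real N / 4 = real m" "3 * real N / 4 = real (3 * m)" "real N / 2 = 2 * real m" using N by auto
    then show ?thesis unfolding mesh_x_def Let_def h1_def h2_def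
      by (simp only: of_nat_le_iff) (use N in simp)
  qed
  \<comment> \<open>The widths add up to 1; hence the middle branch takes the value
    \<open>1 - m * h1\<close> at index \<open>3 * m\<close>, and the step from there to
    \<open>3 * m + 1\<close> is \<open>h1\<close>.\<close>
  have "1 = 2 * (real m * h1) + 2 * real m * h2" using \<sigma>(2) by linarith
  then have "mesh_x \<alpha> \<epsilon> N (Suc j) - mesh_x \<alpha> \<epsilon> N j = (if m \<le> j \<and> j < 3 * m then h2 else h1)"
    unfolding X using N(2) by (auto simp: algebra_simps not_le less_Suc_eq_le le_Suc_eq)
  then show ?thesis by (simp add: h1_def h2_def)
qed

lemma mesh_x_ends:
  assumes "N = 4 * m" "2 \<le> m"
  shows "mesh_x \<alpha> \<epsilon> N 0 = 0" "mesh_x \<alpha> \<epsilon> N N = 1"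
  using assms by (auto simp: mesh_x_def Let_def)

section \<open>Error estimate for fixed \<epsilon>\<close>

context parabolic_problem
begin

lemma discrete_error:
  fixes N M m :: nat
  assumes N: "N = 4 * m" "2 \<le> m" and M: "1 \<le> M"
    and U: "discrete_solution T \<alpha> \<epsilon> N M a f \<phi>L \<phi>R \<phi>B U"
    and j: "j \<le> N" and k: "k \<le> M"
  shows "\<bar>U j k - u (mesh_x \<alpha> \<epsilon> N j) (mesh_t T M k)\<bar> \<le>
    (utt_bound * T / real M + 8 * uxxx_bound / real N) / \<alpha>
    + 8 / sqrt \<alpha> * (4 * ux_bound + uxxx_bound) * (ln (real N) / real N)"
proof -
  define X where "X = mesh_x \<alpha> \<epsilon> N"
  define \<tau> where "\<tau> = mesh_t T M"
  define V where "V = (\<lambda>j k. u (X j) (\<tau> k))"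
  define c1 where "c1 = utt_bound * T / real M + 8 * uxxx_bound / real N"
  define c2 where "c2 = 8 / sqrt \<alpha> * (4 * ux_bound + uxxx_bound) * (ln (real N) / real N)"
  define \<sigma> where "\<sigma> = shishkin_sigma \<alpha> \<epsilon> N"
  have \<sigma>: "0 < \<sigma>" "\<sigma> \<le> 1/4" "\<sigma> \<le> 2 * (sqrt \<epsilon> / sqrt \<alpha>) * ln (real N)"
    unfolding \<sigma>_def using shishkin_sigma_bounds[OF \<epsilon>(1) \<alpha>, of N] N by auto
  note step = mesh_x_step[OF \<epsilon>(1) \<alpha> N, folded X_def \<sigma>_def]
  \<comment> \<open>The middle width is below \<open>1 / (2 * m) = 2 / N\<close>; the outer width is
    at most \<open>1 / (4 * m) = 1 / N\<close>, as \<open>\<sigma> \<le> 1/4\<close>.\<close>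
  have X: "X j < X (Suc j)" "X (Suc j) - X j \<le> 2 / real N" if "j < N" for j
  proof -
    have "0 < X (Suc j) - X j" unfolding step[OF that] using \<sigma> N by auto
    then show "X j < X (Suc j)" by simp
    show "X (Suc j) - X j \<le> 2 / real N"
      unfolding step[OF that] using \<sigma> N by (auto simp: field_simps)
  qed
  have ends: "X 0 = 0" "X N = 1" unfolding X_def by (rule mesh_x_ends[OF N])+
  have mono: "X i \<le> X j" if "i \<le> j" "j \<le> N" for i j
    using that
  proof (induction j rule: dec_induct)
    case (step n)
    then show ?case using X(1)[of n] by simp
  qed simp
  have X01: "X j \<in> {0..1}" if "j \<le> N" for j
    using mono[of 0 j] mono[of j N] that ends by auto
  have \<tau>_step: "\<tau> (Suc k) - \<tau> k = T / real M" for k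
    by (simp add: \<tau>_def mesh_t_def add_divide_distrib distrib_right)
  then have \<tau>_less: "\<tau> k < \<tau> (Suc k)" for k
    using T M by (smt (verit) divide_pos_pos of_nat_0_less_iff less_le_trans zero_less_one)
  have \<tau>T: "\<tau> k \<in> {0..T}" if "k \<le> M" for k
    using that T M by (auto simp: \<tau>_def mesh_t_def field_simps)
  have lnN: "0 \<le> ln (real N)" using N by simp
  have c12: "0 \<le> c1" "0 \<le> c2"
    unfolding c1_def c2_def using bounds_nonneg T \<alpha> lnN
    by (intro add_nonneg_nonneg mult_nonneg_nonneg divide_nonneg_nonneg; simp)+
  have Ueq: "Dt_minus \<tau> U j k - \<epsilon> * delta_x2 X U j k + a (X j) (\<tau> k) * U j k = f (X j) (\<tau> k)"
    if "j \<in> {1..N-1}" "k \<in> {1..M}" for j k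
    using U that by (simp add: discrete_solution_def Let_def X_def \<tau>_def)
  have Ubd: "U 0 k - Dx_plus X U 0 k = \<phi>L (\<tau> k)" "U N k + Dx_minus X U N k = \<phi>R (\<tau> k)"
    if "k \<in> {1..M}" for k
    using U that by (auto simp: discrete_solution_def Let_def X_def \<tau>_def)
  have Uinit: "U j 0 = \<phi>B (X j)" if "j \<le> N" for j
    using U that by (auto simp: discrete_solution_def Let_def X_def \<tau>_def)
  \<comment> \<open>Here the choice of \<sigma> pays: its factor \<open>sqrt \<epsilon>\<close>
    cancels the \<open>1 / sqrt \<epsilon>\<close> in the bound on \<open>u_xx\<close>. With
    \<open>m = N / 4\<close> the factor 2 in \<sigma> becomes the 8 in \<open>c2\<close>.\<close>
  have uxx: "\<bar>D 2 0 x t\<bar> * (\<sigma> / real m) \<le> c2" if "x \<in> {0..1}" "t \<in> {0..T}" for x t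
  proof -
    have "\<bar>D 2 0 x t\<bar> * \<sigma> \<le> \<bar>D 2 0 x t\<bar> * (2 * (sqrt \<epsilon> / sqrt \<alpha>) * ln (real N))"
      using \<sigma> by (intro mult_left_mono) auto
    also have "\<dots> = (sqrt \<epsilon> * \<bar>D 2 0 x t\<bar>) * (2 / sqrt \<alpha> * ln (real N))" by simp
    also have "\<dots> \<le> (4 * ux_bound + uxxx_bound) * (2 / sqrt \<alpha> * ln (real N))"
      using lnN \<alpha> by (intro mult_right_mono uxx_le that) auto
    finally have "\<bar>D 2 0 x t\<bar> * \<sigma> / real m \<le> (4 * ux_bound + uxxx_bound) * (2 / sqrt \<alpha> * ln (real N)) / real m"
      by (rule divide_right_mono) simp
    then show ?thesis using N \<alpha> by (simp add: c2_def field_simps)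
  qed
  \<comment> \<open>The constant is written as \<open>c2\<close> over the boundary mesh width, so
    that one boundary step costs exactly \<open>c2\<close>.\<close>
  have ux_lip: "\<bar>D 1 0 y t - D 1 0 x t\<bar> \<le> c2 / (\<sigma> / real m) * \<bar>y - x\<bar>"
    if "x \<in> {0..1}" "y \<in> {0..1}" "t \<in> {0..T}" for x y t
  proof (rule lipschitz_Icc[where g = "\<lambda>y. D 1 0 y t", OF _ _ that(2,1)])
    fix z :: real assume z: "z \<in> {0..1}"
    show "((\<lambda>y. D 1 0 y t) has_real_derivative D 2 0 z t) (at z within {0..1})"
      using D_dx[OF z that(3), of 1 0] by (simp add: numeral_2_eq_2)
    show "\<bar>D 2 0 z t\<bar> \<le> c2 / (\<sigma> / real m)"
      using uxx[OF z that(3)] \<sigma> N by (simp add: field_simps)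
  qed
  have quot: "\<bar>(u s t - u x t) / (s - x) - D 1 0 x t\<bar> \<le> c2"
    if "x \<in> {0..1}" "s \<in> {0..1}" "\<bar>s - x\<bar> = \<sigma> / real m" "t \<in> {0..T}" for x s t
  proof -
    have "\<bar>(u s t - u x t) / (s - x) - D 1 0 x t\<bar> \<le> c2 / (\<sigma> / real m) * \<bar>s - x\<bar>"
    proof (rule difference_quotient_error[where g = "\<lambda>y. u y t"])
      show "((\<lambda>y. u y t) has_real_derivative D 1 0 z t) (at z within {0..1})" if "z \<in> {0..1}" for z
        using D_dx[OF that \<open>t \<in> _\<close>, of 0 0] by simp
      show "s \<noteq> x" using that \<sigma> N by auto
      show "0 \<le> c2 / (\<sigma> / real m)" using c12 \<sigma> by simp
    qed (use that ux_lip in auto)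
    also have "\<dots> = c2" using that \<sigma> N by simp
    finally show ?thesis .
  qed
  \<comment> \<open>Interior residuals turn out to be at most \<open>c1\<close>, boundary residuals
    at most \<open>c2\<close>; stability then asks for \<open>c1 / \<alpha> + c2\<close>.\<close>
  have "\<bar>U j k - V j k\<bar> \<le> c1 / \<alpha> + c2"
  proof (rule discrete_stability[where E = "\<lambda>j k. U j k - V j k" and X = X and \<tau> = \<tau>
        and b = "\<lambda>j k. a (X j) (\<tau> k)" and \<epsilon> = \<epsilon> and N = N and M = M and \<alpha> = \<alpha>])
    fix j k assume jk: "j \<in> {1..N-1}" "k \<in> {1..M}"
    then have j: "j < N" "j - 1 < N" "Suc (j - 1) = j" and k: "Suc (k - 1) = k" "k - 1 \<le> M" "k \<le> M" by auto
    have x: "X j \<in> {0..1}" "X (j + 1) \<in> {0..1}" "X (j - 1) \<in> {0..1}" using X01 j by auto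
    have t: "\<tau> k \<in> {0..T}" "\<tau> (k - 1) \<in> {0..T}" using \<tau>T k by auto
    show "\<alpha> \<le> a (X j) (\<tau> k)" by (rule a_lower[OF x(1) t(1)])
    \<comment> \<open>The backward quotient is read as a quotient based at the current time with
      \<open>s\<close> the previous one; the two sign changes cancel.\<close>
    have "\<bar>(u (X j) (\<tau> (k - 1)) - u (X j) (\<tau> k)) / (\<tau> (k - 1) - \<tau> k) - D 0 1 (X j) (\<tau> k)\<bar>
        \<le> utt_bound * \<bar>\<tau> (k - 1) - \<tau> k\<bar>"
    proof (rule difference_quotient_error[OF _ _ _ t])
      show "(u (X j) has_real_derivative D 0 1 (X j) s) (at s within {0..T})" if "s \<in> {0..T}" for s
        using D_dt0[OF x(1) that, of 0] by simp
      show "\<tau> (k - 1) \<noteq> \<tau> k" using \<tau>_less[of "k - 1"] k by simp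
    qed (use ut_lipschitz[OF x(1)] t bounds_nonneg in auto)
    moreover have "(u (X j) (\<tau> (k - 1)) - u (X j) (\<tau> k)) / (\<tau> (k - 1) - \<tau> k) = Dt_minus \<tau> V j k"
      unfolding Dt_minus_def V_def by (metis minus_diff_eq minus_divide_divide)
    moreover have "\<bar>\<tau> (k - 1) - \<tau> k\<bar> = T / real M"
      using \<tau>_step[of "k - 1"] \<tau>_less[of "k - 1"] k by simp
    ultimately have time: "\<bar>Dt_minus \<tau> V j k - D 0 1 (X j) (\<tau> k)\<bar> \<le> utt_bound * T / real M" by simp
    have "\<bar>2 / (X (j + 1) - X (j - 1)) * ((u (X (j + 1)) (\<tau> k) - u (X j) (\<tau> k)) / (X (j + 1) - X j)
        - (u (X j) (\<tau> k) - u (X (j - 1)) (\<tau> k)) / (X j - X (j - 1))) - D 2 0 (X j) (\<tau> k)\<bar>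
        \<le> 2 * (uxxx_bound / \<epsilon>) * (X (j + 1) - X (j - 1))"
    proof (rule second_difference_error[where p = 0 and q = 1 and g = "\<lambda>y. u y (\<tau> k)"])
      fix y :: real assume y: "y \<in> {0..1}"
      show "((\<lambda>y. u y (\<tau> k)) has_real_derivative D 1 0 y (\<tau> k)) (at y within {0..1})"
        "((\<lambda>y. D 1 0 y (\<tau> k)) has_real_derivative D 2 0 y (\<tau> k)) (at y within {0..1})"
        "((\<lambda>y. D 2 0 y (\<tau> k)) has_real_derivative D 3 0 y (\<tau> k)) (at y within {0..1})"
        using D_dx[OF y t(1), of 0 0] D_dx[OF y t(1), of 1 0] D_dx[OF y t(1), of 2 0]
        by (simp_all add: numeral_2_eq_2 numeral_3_eq_3)
      show "\<bar>D 3 0 y (\<tau> k)\<bar> \<le> uxxx_bound / \<epsilon>"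
        using uxxx_le[OF y t(1)] \<epsilon> by (simp add: field_simps)
    next
      show "X (j - 1) < X j" "X j < X (j + 1)" using X(1)[OF j(2)] X(1)[OF j(1)] j by simp_all
    qed (use x in auto)
    \<comment> \<open>Two neighbouring widths, each at most \<open>2 / N\<close>, also across the
      transition points; multiplication by \<epsilon> then removes
      \<open>1 / \<epsilon>\<close>.\<close>
    also have "\<dots> \<le> 2 * (uxxx_bound / \<epsilon>) * (4 / real N)"
      using X(2)[OF j(1)] X(2)[OF j(2)] j bounds_nonneg \<epsilon> by (intro mult_left_mono) auto
    finally have "\<bar>delta_x2 X V j k - D 2 0 (X j) (\<tau> k)\<bar> \<le> 2 * (uxxx_bound / \<epsilon>) * (4 / real N)"
      by (simp add: delta_x2_def Dx_plus_def Dx_minus_def V_def)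
    then have "\<epsilon> * \<bar>delta_x2 X V j k - D 2 0 (X j) (\<tau> k)\<bar> \<le> \<epsilon> * (2 * (uxxx_bound / \<epsilon>) * (4 / real N))"
      using \<epsilon> by (intro mult_left_mono) auto
    then have space: "\<bar>\<epsilon> * delta_x2 X V j k - \<epsilon> * D 2 0 (X j) (\<tau> k)\<bar> \<le> 8 * uxxx_bound / real N"
      using \<epsilon> by (simp add: abs_mult flip: right_diff_distrib)
    \<comment> \<open>Since \<open>U\<close> satisfies the scheme exactly, the residual of the error
      is minus the truncation error of \<open>u\<close>.\<close>
    have "Dt_minus \<tau> (\<lambda>j k. U j k - V j k) j k - \<epsilon> * delta_x2 X (\<lambda>j k. U j k - V j k) j k
        + a (X j) (\<tau> k) * (U j k - V j k)
      = f (X j) (\<tau> k) - (Dt_minus \<tau> V j k - \<epsilon> * delta_x2 X V j k + a (X j) (\<tau> k) * V j k)"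
      unfolding difference_minus Ueq[OF jk, symmetric] by (simp add: algebra_simps)
    also have "\<dots> = (\<epsilon> * delta_x2 X V j k - \<epsilon> * D 2 0 (X j) (\<tau> k)) - (Dt_minus \<tau> V j k - D 0 1 (X j) (\<tau> k))"
      using pde[OF x(1) t(1)] by (simp add: V_def)
    finally have "\<bar>Dt_minus \<tau> (\<lambda>j k. U j k - V j k) j k - \<epsilon> * delta_x2 X (\<lambda>j k. U j k - V j k) j k
        + a (X j) (\<tau> k) * (U j k - V j k)\<bar> \<le> c1"
      unfolding c1_def using time space by linarith
    also have "c1 \<le> \<alpha> * (c1 / \<alpha> + c2)" using \<alpha> c12 by (simp add: distrib_left)
    finally show "\<bar>Dt_minus \<tau> (\<lambda>j k. U j k - V j k) j k - \<epsilon> * delta_x2 X (\<lambda>j k. U j k - V j k) j k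
        + a (X j) (\<tau> k) * (U j k - V j k)\<bar> \<le> \<alpha> * (c1 / \<alpha> + c2)" .
  next
    fix k assume k: "k \<in> {1..M}"
    then have t: "\<tau> k \<in> {0..T}" using \<tau>T by simp
    have c2: "c2 \<le> c1 / \<alpha> + c2" using c12 \<alpha> by simp
    have N0: "0 < N" "N - 1 < N" "Suc (N - 1) = N" using N by auto
    have x1: "X (Suc 0) - X 0 = \<sigma> / real m" using step[of 0] N by simp
    have "\<bar>(u (X 1) (\<tau> k) - u 0 (\<tau> k)) / (X 1 - 0) - D 1 0 0 (\<tau> k)\<bar> \<le> c2"
      by (rule quot) (use X01[of 1] N t x1 \<sigma> ends in auto)
    then have "\<bar>U 0 k - V 0 k - Dx_plus X (\<lambda>j k. U j k - V j k) 0 k\<bar> \<le> c2"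
      using Ubd(1)[OF k] boundary(1)[OF t] ends unfolding difference_minus by (simp add: Dx_plus_def V_def)
    then show "\<bar>U 0 k - V 0 k - Dx_plus X (\<lambda>j k. U j k - V j k) 0 k\<bar> \<le> c1 / \<alpha> + c2"
      using c2 by linarith
    have xN: "X N - X (N - 1) = \<sigma> / real m" using step[OF N0(2)] N unfolding N0(3) by auto
    have "\<bar>(u (X (N - 1)) (\<tau> k) - u 1 (\<tau> k)) / (X (N - 1) - 1) - D 1 0 1 (\<tau> k)\<bar> \<le> c2"
      by (rule quot) (use X01[of "N - 1"] N t xN \<sigma> ends in auto)
    moreover have "(u (X (N - 1)) (\<tau> k) - u 1 (\<tau> k)) / (X (N - 1) - 1) = Dx_minus X V N k"
      unfolding Dx_minus_def V_def ends by (metis minus_diff_eq minus_divide_divide)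
    ultimately have "\<bar>U N k - V N k + Dx_minus X (\<lambda>j k. U j k - V j k) N k\<bar> \<le> c2"
      using Ubd(2)[OF k] boundary(2)[OF t] ends unfolding difference_minus by (simp add: V_def)
    then show "\<bar>U N k - V N k + Dx_minus X (\<lambda>j k. U j k - V j k) N k\<bar> \<le> c1 / \<alpha> + c2"
      using c2 by linarith
  next
    fix j assume j: "j \<le> N"
    have "V j 0 = \<phi>B (X j)" using initial[OF X01[OF j]] by (simp add: V_def \<tau>_def mesh_t_def)
    then show "\<bar>U j 0 - V j 0\<bar> \<le> c1 / \<alpha> + c2" using Uinit[OF j] c12 \<alpha> by simp
  qed (use N X \<tau>_less \<epsilon> \<alpha> c12 j k in auto)
  then show ?thesis by (simp add: V_def X_def \<tau>_def c1_def c2_def)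
qed

lemma max_error_le:
  assumes N: "N = 4 * m" "2 \<le> m" and M: "1 \<le> M"
    and U: "discrete_solution T \<alpha> \<epsilon> N M a f \<phi>L \<phi>R \<phi>B U"
  shows "max_error T \<alpha> \<epsilon> N M U u \<le>
    ((utt_bound * T + 8 * uxxx_bound) / \<alpha> + 8 / sqrt \<alpha> * (4 * ux_bound + uxxx_bound))
      * (1 / real M + ln (real N) / real N)"
proof -
  \<comment> \<open>\<open>N\<close> is at least 8, so \<open>ln N \<ge> 1\<close> and the interior
    term \<open>1 / N\<close> is absorbed into \<open>ln N / N\<close>.\<close>
  have "exp 1 \<le> real N" using exp_le N by simp
  then have ln1: "1 \<le> ln (real N)" using N by (subst ln_ge_iff) auto
  have NM: "0 < real N" "0 < real M" using N M by auto
  define A where "A = utt_bound * T / \<alpha>"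
  define B' where "B' = 8 * uxxx_bound / \<alpha>"
  define C where "C = 8 / sqrt \<alpha> * (4 * ux_bound + uxxx_bound)"
  have nn: "0 \<le> A" "0 \<le> B'" "0 \<le> C"
    unfolding A_def B'_def C_def using bounds_nonneg T \<alpha> by auto
  have "(utt_bound * T / real M + 8 * uxxx_bound / real N) / \<alpha> + C * (ln (real N) / real N)
      = A * (1 / real M) + B' * (1 / real N) + C * (ln (real N) / real N)"
    using NM \<alpha> by (simp add: A_def B'_def field_simps)
  also have "\<dots> \<le> (A + B' + C) * (1 / real M) + (A + B' + C) * (ln (real N) / real N)"
  proof -
    have "B' * (1 / real N) \<le> B' * (ln (real N) / real N)"
      using nn NM ln1 by (intro mult_left_mono divide_right_mono) auto
    moreover have "0 \<le> (B' + C) * (1 / real M)" "0 \<le> A * (ln (real N) / real N)"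
      using nn NM ln1 by auto
    ultimately show ?thesis by (simp only: distrib_right)
  qed
  finally have le: "(utt_bound * T / real M + 8 * uxxx_bound / real N) / \<alpha> + C * (ln (real N) / real N)
      \<le> ((utt_bound * T + 8 * uxxx_bound) / \<alpha> + C) * (1 / real M + ln (real N) / real N)"
    by (simp add: A_def B'_def distrib_left add_divide_distrib)
  show ?thesis unfolding max_error_def
  proof (rule Max.boundedI)
    fix z assume "z \<in> (\<lambda>(j, k). \<bar>U j k - u (mesh_x \<alpha> \<epsilon> N j) (mesh_t T M k)\<bar>) ` ({0..N} \<times> {0..M})"
    then obtain j k where "j \<le> N" "k \<le> M" "z = \<bar>U j k - u (mesh_x \<alpha> \<epsilon> N j) (mesh_t T M k)\<bar>" by auto
    then have "z \<le> (utt_bound * T / real M + 8 * uxxx_bound / real N) / \<alpha> + C * (ln (real N) / real N)"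
      using discrete_error[OF N M U] by (simp add: C_def)
    also note le
    finally show "z \<le> ((utt_bound * T + 8 * uxxx_bound) / \<alpha> + 8 / sqrt \<alpha> * (4 * ux_bound + uxxx_bound))
      * (1 / real M + ln (real N) / real N)" by (simp add: C_def)
  qed auto
qed

end

section \<open>Uniformity of the constant\<close>

lemma standing_assumptions_imp_parabolic_data:
  assumes "standing_assumptions 2 T \<alpha> a f \<phi>L \<phi>R \<phi>B"
  obtains B where "parabolic_data T \<alpha> a f \<phi>L \<phi>R \<phi>B B"
proof -
  note sa = assms[unfolded standing_assumptions_def]
  obtain b1 where b1: "\<And>i j x t. i + j \<le> 2 \<Longrightarrow> x \<in> {0..1} \<Longrightarrow> t \<in> {0..T} \<Longrightarrow> \<bar>partial T i j a x t\<bar> \<le> b1"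
    using class_C_rect_bounded[of 2 T a] sa by blast
  obtain b2 where b2: "\<And>i j x t. i + j \<le> 2 \<Longrightarrow> x \<in> {0..1} \<Longrightarrow> t \<in> {0..T} \<Longrightarrow> \<bar>partial T i j f x t\<bar> \<le> b2"
    using class_C_rect_bounded[of 2 T f] sa by blast
  obtain b3 where b3: "\<And>i t. i \<le> 2 \<Longrightarrow> t \<in> {0..T} \<Longrightarrow> \<bar>(deriv_on 0 T ^^ i) \<phi>L t\<bar> \<le> b3"
    using class_C_bounded[of 2 0 T \<phi>L] sa by blast
  obtain b4 where b4: "\<And>i t. i \<le> 2 \<Longrightarrow> t \<in> {0..T} \<Longrightarrow> \<bar>(deriv_on 0 T ^^ i) \<phi>R t\<bar> \<le> b4"
    using class_C_bounded[of 2 0 T \<phi>R] sa by blast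
  obtain b5 where b5: "\<And>i x. i \<le> 5 \<Longrightarrow> x \<in> {0..1} \<Longrightarrow> \<bar>(deriv_on 0 1 ^^ i) \<phi>B x\<bar> \<le> b5"
    using class_C_bounded[of 5 0 1 \<phi>B] sa by blast
  define b where "b = Max {b1, b2, b3, b4, b5}"
  have b: "b1 \<le> b" "b2 \<le> b" "b3 \<le> b" "b4 \<le> b" "b5 \<le> b" by (auto simp: b_def)
  have "parabolic_data T \<alpha> a f \<phi>L \<phi>R \<phi>B b"
    by unfold_locales
      (use sa in \<open>auto intro: less_imp_le order_trans[OF b1 b(1)] order_trans[OF b2 b(2)]
         order_trans[OF b3 b(3)] order_trans[OF b4 b(4)] order_trans[OF b5 b(5)]\<close>)
  then show ?thesis by (rule that)
qed

theorem theorem7p3: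
  "\<exists>K::nat. \<forall>(T::real) (\<alpha>::real) (a::real \<Rightarrow> real \<Rightarrow> real) (f::real \<Rightarrow> real \<Rightarrow> real)
       (\<phi>L::real \<Rightarrow> real) (\<phi>R::real \<Rightarrow> real) (\<phi>B::real \<Rightarrow> real).
     standing_assumptions K T \<alpha> a f \<phi>L \<phi>R \<phi>B \<longrightarrow>
     (\<exists>C::real. \<forall>(\<epsilon>::real) (N::nat) (M::nat) (u::real \<Rightarrow> real \<Rightarrow> real) (U::nat \<Rightarrow> nat \<Rightarrow> real).
        0 < \<epsilon> \<and> \<epsilon> \<le> 1 \<and> (\<exists>m\<ge>2. N = 4 * m) \<and> 1 \<le> M \<and>
        continuous_solution T \<epsilon> a f \<phi>L \<phi>R \<phi>B u \<and>
        discrete_solution T \<alpha> \<epsilon> N M a f \<phi>L \<phi>R \<phi>B U \<longrightarrow>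
        max_error T \<alpha> \<epsilon> N M U u \<le> C * (1 / real M + ln (real N) / real N))"
\<comment> \<open>Order 2 for \<open>a\<close> and \<open>f\<close>: the sources of the problems for
  \<open>u_t\<close> and \<open>u_x\<close> must be Lipschitz in time, and
  \<open>initial_ut_xx\<close> involves second \<open>x\<close>-derivatives.\<close>
proof (rule exI[of _ 2], intro allI impI)
  fix T \<alpha> a f \<phi>L \<phi>R \<phi>B assume "standing_assumptions 2 T \<alpha> a f \<phi>L \<phi>R \<phi>B"
  then obtain B where "parabolic_data T \<alpha> a f \<phi>L \<phi>R \<phi>B B"
    by (rule standing_assumptions_imp_parabolic_data)
  then interpret parabolic_data T \<alpha> a f \<phi>L \<phi>R \<phi>B B .
  show "\<exists>C. \<forall>\<epsilon> N M u U. 0 < \<epsilon> \<and> \<epsilon> \<le> 1 \<and> (\<exists>m\<ge>2. N = 4 * m) \<and> 1 \<le> M \<and>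
        continuous_solution T \<epsilon> a f \<phi>L \<phi>R \<phi>B u \<and>
        discrete_solution T \<alpha> \<epsilon> N M a f \<phi>L \<phi>R \<phi>B U \<longrightarrow>
        max_error T \<alpha> \<epsilon> N M U u \<le> C * (1 / real M + ln (real N) / real N)"
  \<comment> \<open>The witness stays schematic until the final \<open>show\<close>; it is made of
    constants of the data locale and so cannot depend on the variables fixed next.\<close>
  proof (intro exI allI impI, elim conjE exE)
    fix \<epsilon> N M u U m
    assume *: "0 < \<epsilon>" "\<epsilon> \<le> 1" "N = 4 * m" "2 \<le> m" "1 \<le> M"
      "continuous_solution T \<epsilon> a f \<phi>L \<phi>R \<phi>B u" "discrete_solution T \<alpha> \<epsilon> N M a f \<phi>L \<phi>R \<phi>B U"
    interpret parabolic_problem T \<alpha> a f \<phi>L \<phi>R \<phi>B B \<epsilon> u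
      by unfold_locales (use * in auto)
    show "max_error T \<alpha> \<epsilon> N M U u \<le>
      ((utt_bound * T + 8 * uxxx_bound) / \<alpha> + 8 / sqrt \<alpha> * (4 * ux_bound + uxxx_bound))
        * (1 / real M + ln (real N) / real N)"
      by (rule max_error_le) (use * in auto)
  qed
qed

end
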